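(* Let $\pi$ be an irreducible representation of $G=\mathrm{GL}_4(\mathfrak{o}_2)$ whose orbit contains $\beta_1=\begin{pmatrix}\eta&1\\0&\eta\end{pmatrix}$, and let $\rho$ be the $1$-dimensional representation of $G(\psi_{\beta_1})$, uniquely determined by $\pi$, such that $\rho|_{K_1}=\psi_{\beta_1}$ and $\pi=\mathrm{Ind}_{G(\psi_{\beta_1})}^{G}\rho$. Then $\pi$ is cuspidal if and only if the restriction of $\rho$ to $G(\psi_{\beta_1})\cap U_{2,2}$ does not contain the trivial representation of $G(\psi_{\beta_1})\cap U_{2,2}$.
   Context: All representations are finite-dimensional and complex. $F$ is an arbitrary (non-archimedean) local field with ring of integers $\mathfrak{o}$, maximal ideal $\mathfrak{p}$ and finite residue field $\mathbb{F}_q$; $\mathfrak{o}_2=\mathfrak{o}/\mathfrak{p}^2$, $G=\mathrm{GL}_4(\mathfrak{o}_2)$, and $K_1$ is the kernel of the reduction map $G\to \mathrm{GL}_4(\mathbb{F}_q)$. Let $\eta$ be an element generating the extension $\mathbb{F}_{q^2}/\mathbb{F}_q$. Embed $\mathbb{F}_{q^2}\hookrightarrow M_2(\mathbb{F}_q)$ via its action on itself by multiplication, using the $\mathbb{F}_q$-basis $\{1,\eta\}$ of $\mathbb{F}_{q^2}$; this gives an embedding $M_2(\mathbb{F}_{q^2})\subset M_4(\mathbb{F}_q)$ (entries become $2\times 2$ blocks), through which $\beta_1$ is viewed as an element of $M_4(\mathbb{F}_q)$. Orbit. Fix an additive character $\psi$ of $\mathfrak{o}$ with conductor $\mathfrak{p}^2$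 (trivial on $\mathfrak{p}^2$, non-trivial on $\mathfrak{p}$). For $\beta\in M_4(\mathbb{F}_q)$ define the character $\psi_\beta:K_1\to\mathbb{C}^\times$ by $\psi_\beta(x)=\psi(\mathrm{Tr}(\beta(x-1)))$ (computed with any lift of $\beta$ to $M_4(\mathfrak{o}_2)$). Every character of the abelian group $K_1$ is of this form for a unique $\beta$. For an irreducible representation $\pi$ of $G$, the set of $\beta$ such that $\psi_\beta$ occurs in $\pi|_{K_1}$ is a single $\mathrm{GL}_4(\mathbb{F}_q)$-conjugacy class in $M_4(\mathbb{F}_q)$, called the orbit of $\pi$. $G(\psi_\beta)$ denotes the stabilizer in $G$ of $\psi_\beta$ under the conjugation action of $G$ on characters of $K_1$; it is the preimage in $G$ of the centralizer of $\beta$ in $\mathrm{GL}_4(\mathbb{F}_q)$. Since $\beta_1$ is regular, it is known (Hill) that the representation $\rho$ in the claim exists and is uniquely determined by $\pi$. Geometric induction. For $(i,j)\in\{(1,3),(2,2),(3,1)\}$, let $U_{i,j}\subset G$ be the group of block matrices $\begin{pmatrix} I_i & *\\ 0& I_j\end{pmatrix}$ over $\mathfrak{o}_2$. Infinitesimal induction. For each partition $\lambda\in\{(2,1^3),(2^2,1^2),(2^3,1)\}$, let $M_\lambda=\bigoplus_i \mathfrak{o}/\mathfrak{p}^{\lambda_i}$, embedded as a submodule of $\mathfrak{o}_2^4$; let $P_{\lambda\hookrightarrow 2^4}$ be the stabilizer of this submodule in $G$, and let $U_{\lambda\hookrightarrow 2^4}$ be the kernel of the natural map $P_{\lambda\hookrightarrow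 2^4}\to \mathrm{Aut}_{\mathfrak{o}}(M_\lambda)$ given by restriction. Cuspidality. An irreducible representation $\pi$ of $G$ is cuspidal if for every character $\chi:\mathfrak{o}_2^\times\to\mathbb{C}^\times$ the twist $\pi\otimes(\chi\circ\det)$ has no non-zero vector fixed by any of the groups $U_{i,j}$ or $U_{\lambda\hookrightarrow 2^4}$ above. *)

theory Defs
  imports Complex_Main "Jordan_Normal_Form.VS_Connect" "Jordan_Normal_Form.Determinant"
begin

section \<open>Local fields and finite quotients of their rings of integers\<close>

text \<open>
  A non-archimedean local field is a field with a normalised discrete valuation \<open>v\<close>, complete
  for \<open>v\<close> and with finite residue field. The value \<open>v 0\<close>, morally infinite, is never used.
  \<open>pideal v k\<close> is the fractional ideal of elements of valuation at least \<open>k\<close>; thus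
  \<open>pideal v 0\<close> is the ring of integers, \<open>pideal v 1\<close> its maximal ideal and \<open>pideal v 2\<close> the
  square of the latter.
\<close>

definition pideal :: "('a::field \<Rightarrow> int) \<Rightarrow> int \<Rightarrow> 'a set" where
  "pideal v k = {x. x = 0 \<or> v x \<ge> k}"

abbreviation integers :: "('a::field \<Rightarrow> int) \<Rightarrow> 'a set" where
  "integers v \<equiv> pideal v 0"

definition nonarch_local_field :: "('a::field \<Rightarrow> int) \<Rightarrow> bool" where
  "nonarch_local_field v \<longleftrightarrow>
     (\<forall>x y. x \<noteq> 0 \<longrightarrow> y \<noteq> 0 \<longrightarrow> v (x * y) = v x + v y) \<and>
     (\<forall>x y. x \<noteq> 0 \<longrightarrow> y \<noteq> 0 \<longrightarrow> x + y \<noteq> 0 \<longrightarrow> v (x + y) \<ge> min (v x) (v y)) \<and>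
     (\<exists>x. x \<noteq> 0 \<and> v x = 1) \<and>
     (\<forall>s :: nat \<Rightarrow> 'a.
        (\<forall>k. \<exists>M. \<forall>m\<ge>M. \<forall>n\<ge>M. s m - s n \<in> pideal v k) \<longrightarrow>
        (\<exists>l. \<forall>k. \<exists>M. \<forall>n\<ge>M. s n - l \<in> pideal v k)) \<and>
     finite (integers v // {(x, y). x \<in> integers v \<and> y \<in> integers v \<and> x - y \<in> pideal v 1})"

text \<open>
  \<open>f\<close> exhibits the type \<open>'r\<close> as the quotient of the subring \<open>R\<close> by its ideal \<open>I\<close>. Values of
  \<open>f\<close> outside \<open>R\<close> are irrelevant.
\<close>

definition quotient_map :: "'a::comm_ring_1 set \<Rightarrow> 'a set \<Rightarrow> ('a \<Rightarrow> 'r::comm_ring_1) \<Rightarrow> bool" where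
  "quotient_map R I f \<longleftrightarrow>
     f 1 = 1 \<and>
     (\<forall>x\<in>R. \<forall>y\<in>R. f (x + y) = f x + f y \<and> f (x * y) = f x * f y) \<and>
     f ` R = UNIV \<and>
     (\<forall>x\<in>R. f x = 0 \<longleftrightarrow> x \<in> I)"

text \<open>
  In the following, \<open>v\<close> is the valuation and \<open>r2\<close>, \<open>r1\<close> are the quotient maps from the ring of
  integers to its quotients modulo the square of the maximal ideal and modulo the maximal ideal.
  Lifts are chosen with \<open>inv_into\<close>; \<open>reduction\<close> does not depend on the choice.
\<close>

definition reduction ::
    "('a::field \<Rightarrow> int) \<Rightarrow> ('a \<Rightarrow> 'r::comm_ring_1) \<Rightarrow> ('a \<Rightarrow> 'k::field) \<Rightarrow> 'r \<Rightarrow> 'k" where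
  "reduction v r2 r1 y = r1 (inv_into (integers v) r2 y)"

text \<open>An additive character of the ring of integers, trivial on the square of the maximal ideal
  but not on the maximal ideal.\<close>

definition additive_char_conductor2 ::
    "('a::field \<Rightarrow> int) \<Rightarrow> ('a \<Rightarrow> complex) \<Rightarrow> bool" where
  "additive_char_conductor2 v \<psi> \<longleftrightarrow>
     (\<forall>x\<in>integers v. \<forall>y\<in>integers v. \<psi> (x + y) = \<psi> x * \<psi> y) \<and>
     (\<forall>x\<in>pideal v 2. \<psi> x = 1) \<and>
     (\<exists>x\<in>pideal v 1. \<psi> x \<noteq> 1)"


section \<open>Quadratic extension of the residue field\<close>

definition generates_over :: "('k::field \<Rightarrow> 'l::field) \<Rightarrow> 'l \<Rightarrow> bool" where
  "generates_over \<iota> \<eta> \<longleftrightarrow>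
     (\<forall>S. range \<iota> \<subseteq> S \<longrightarrow> \<eta> \<in> S \<longrightarrow>
        (\<forall>x\<in>S. \<forall>y\<in>S. x - y \<in> S \<and> x * y \<in> S \<and> inverse x \<in> S) \<longrightarrow> S = UNIV)"

text \<open>Coordinates with respect to the basis \<open>1, \<eta>\<close>, and the matrix of multiplication by \<open>x\<close> in
  that basis, acting on column vectors.\<close>

definition coords :: "('k::field \<Rightarrow> 'l::field) \<Rightarrow> 'l \<Rightarrow> 'l \<Rightarrow> 'k vec" where
  "coords \<iota> \<eta> y = (THE c. c \<in> carrier_vec 2 \<and> y = \<iota> (c $ 0) + \<iota> (c $ 1) * \<eta>)"

definition mult_matrix :: "('k::field \<Rightarrow> 'l::field) \<Rightarrow> 'l \<Rightarrow> 'l \<Rightarrow> 'k mat" where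
  "mult_matrix \<iota> \<eta> x = mat_of_cols 2 (map (\<lambda>b. coords \<iota> \<eta> (x * b)) [1, \<eta>])"

definition embed_M2 :: "('k::field \<Rightarrow> 'l::field) \<Rightarrow> 'l \<Rightarrow> 'l mat \<Rightarrow> 'k mat" where
  "embed_M2 \<iota> \<eta> B =
     four_block_mat (mult_matrix \<iota> \<eta> (B $$ (0, 0))) (mult_matrix \<iota> \<eta> (B $$ (0, 1)))
                    (mult_matrix \<iota> \<eta> (B $$ (1, 0))) (mult_matrix \<iota> \<eta> (B $$ (1, 1)))"

definition beta1 :: "('k::field \<Rightarrow> 'l::field) \<Rightarrow> 'l \<Rightarrow> 'k mat" where
  "beta1 \<iota> \<eta> = embed_M2 \<iota> \<eta> (mat_of_rows_list 2 [[\<eta>, 1], [0, \<eta>]])"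


section \<open>Representations\<close>

definition GL :: "'a::comm_ring_1 itself \<Rightarrow> nat \<Rightarrow> 'a mat monoid" where
  "GL ty n = units_of (ring_mat ty n ())"

text \<open>Finite-dimensional complex representations are taken in matrix form.\<close>

definition is_rep :: "'g monoid \<Rightarrow> nat \<Rightarrow> ('g \<Rightarrow> complex mat) \<Rightarrow> bool" where
  "is_rep G n \<pi> \<longleftrightarrow> \<pi> \<in> hom G (GL TYPE(complex) n)"

definition irreducible_rep :: "'g monoid \<Rightarrow> nat \<Rightarrow> ('g \<Rightarrow> complex mat) \<Rightarrow> bool" where
  "irreducible_rep G n \<pi> \<longleftrightarrow>
     is_rep G n \<pi> \<and> n > 0 \<and>
     (\<forall>W. subspace class_ring W (module_vec TYPE(complex) n) \<longrightarrow>
        (\<forall>g\<in>carrier G. \<forall>w\<in>W. \<pi> g *\<^sub>v w \<in> W) \<longrightarrow>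
        W = {0\<^sub>v n} \<or> W = carrier_vec n)"

text \<open>The restriction to \<open>H\<close> of the \<open>n\<close>-dimensional representation \<open>\<pi>\<close> contains the
  one-dimensional representation given by \<open>\<chi>\<close>.\<close>

definition contains_char ::
    "'g set \<Rightarrow> nat \<Rightarrow> ('g \<Rightarrow> complex mat) \<Rightarrow> ('g \<Rightarrow> complex) \<Rightarrow> bool" where
  "contains_char H n \<pi> \<chi> \<longleftrightarrow>
     (\<exists>w\<in>carrier_vec n. w \<noteq> 0\<^sub>v n \<and> (\<forall>h\<in>H. \<pi> h *\<^sub>v w = \<chi> h \<cdot>\<^sub>v w))"

abbreviation contains_trivial :: "'g set \<Rightarrow> nat \<Rightarrow> ('g \<Rightarrow> complex mat) \<Rightarrow> bool" where
  "contains_trivial H n \<pi> \<equiv> contains_char H n \<pi> (\<lambda>_. 1)"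

text \<open>
  The space of the representation of \<open>G\<close> induced from the \<open>m\<close>-dimensional representation \<open>\<rho>\<close> of
  \<open>H\<close>; \<open>G\<close> acts on it by right translation. Functions are extended by zero off the carrier.
\<close>

definition ind_space ::
    "'g monoid \<Rightarrow> 'g set \<Rightarrow> nat \<Rightarrow> ('g \<Rightarrow> complex mat) \<Rightarrow> ('g \<Rightarrow> complex vec) set" where
  "ind_space G H m \<rho> =
     {f. (\<forall>x\<in>carrier G. f x \<in> carrier_vec m) \<and>
         (\<forall>x. x \<notin> carrier G \<longrightarrow> f x = 0\<^sub>v m) \<and>
         (\<forall>h\<in>H. \<forall>x\<in>carrier G. f (h \<otimes>\<^bsub>G\<^esub> x) = \<rho> h *\<^sub>v f x)}"

definition iso_to_induced ::
    "'g monoid \<Rightarrow> nat \<Rightarrow> ('g \<Rightarrow> complex mat) \<Rightarrow> 'g set \<Rightarrow> nat \<Rightarrow> ('g \<Rightarrow> complex mat) \<Rightarrow> bool" where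
  "iso_to_induced G n \<pi> H m \<rho> \<longleftrightarrow>
     (\<exists>T. bij_betw T (carrier_vec n) (ind_space G H m \<rho>) \<and>
        (\<forall>u\<in>carrier_vec n. \<forall>w\<in>carrier_vec n. T (u + w) = (\<lambda>x. T u x + T w x)) \<and>
        (\<forall>c. \<forall>w\<in>carrier_vec n. T (c \<cdot>\<^sub>v w) = (\<lambda>x. c \<cdot>\<^sub>v T w x)) \<and>
        (\<forall>g\<in>carrier G. \<forall>w\<in>carrier_vec n. \<forall>x\<in>carrier G.
           T (\<pi> g *\<^sub>v w) x = T w (x \<otimes>\<^bsub>G\<^esub> g)))"


section \<open>Orbits\<close>

definition K1 ::
    "('a::field \<Rightarrow> int) \<Rightarrow> ('a \<Rightarrow> 'r::comm_ring_1) \<Rightarrow> ('a \<Rightarrow> 'k::field) \<Rightarrow> 'r mat set" where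
  "K1 v r2 r1 = kernel (GL TYPE('r) 4) (GL TYPE('k) 4) (map_mat (reduction v r2 r1))"

definition mat_trace :: "'a::comm_monoid_add mat \<Rightarrow> 'a" where
  "mat_trace A = (\<Sum>i<dim_row A. A $$ (i, i))"

text \<open>\<open>\<psi>\<close> is evaluated on the quotient via a lift, and \<open>\<beta>\<close> is lifted entrywise; on \<open>K1\<close> the
  value does not depend on either choice.\<close>

definition psi_char ::
    "('a::field \<Rightarrow> int) \<Rightarrow> ('a \<Rightarrow> 'r::comm_ring_1) \<Rightarrow> ('a \<Rightarrow> 'k::field) \<Rightarrow> ('a \<Rightarrow> complex) \<Rightarrow>
     'k mat \<Rightarrow> 'r mat \<Rightarrow> complex" where
  "psi_char v r2 r1 \<psi> \<beta> x =
     \<psi> (inv_into (integers v) r2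
          (mat_trace (map_mat (\<lambda>b. r2 (inv_into (integers v) r1 b)) \<beta> * (x - 1\<^sub>m 4))))"

definition rep_orbit ::
    "('a::field \<Rightarrow> int) \<Rightarrow> ('a \<Rightarrow> 'r::comm_ring_1) \<Rightarrow> ('a \<Rightarrow> 'k::field) \<Rightarrow> ('a \<Rightarrow> complex) \<Rightarrow>
     nat \<Rightarrow> ('r mat \<Rightarrow> complex mat) \<Rightarrow> 'k mat set" where
  "rep_orbit v r2 r1 \<psi> n \<pi> =
     {\<beta> \<in> carrier_mat 4 4. contains_char (K1 v r2 r1) n \<pi> (psi_char v r2 r1 \<psi> \<beta>)}"

definition char_stabilizer ::
    "('a::field \<Rightarrow> int) \<Rightarrow> ('a \<Rightarrow> 'r::comm_ring_1) \<Rightarrow> ('a \<Rightarrow> 'k::field) \<Rightarrow> ('a \<Rightarrow> complex) \<Rightarrow>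
     'k mat \<Rightarrow> 'r mat set" where
  "char_stabilizer v r2 r1 \<psi> \<beta> =
     {g \<in> carrier (GL TYPE('r) 4). \<forall>x\<in>K1 v r2 r1.
        psi_char v r2 r1 \<psi> \<beta>
          (inv\<^bsub>GL TYPE('r) 4\<^esub> g \<otimes>\<^bsub>GL TYPE('r) 4\<^esub> x \<otimes>\<^bsub>GL TYPE('r) 4\<^esub> g) = psi_char v r2 r1 \<psi> \<beta> x}"


section \<open>Cuspidality\<close>

definition U_geom :: "nat \<Rightarrow> nat \<Rightarrow> 'r::comm_ring_1 mat set" where
  "U_geom i j = {four_block_mat (1\<^sub>m i) B (0\<^sub>m j i) (1\<^sub>m j) | B. B \<in> carrier_mat i j}"

text \<open>
  For a partition \<open>\<lambda>\<close> with four parts, each 1 or 2, the module with elementary divisors \<open>\<lambda>\<close> is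
  embedded coordinatewise: the summand for the part \<open>\<lambda> ! i\<close> is the image of the ideal
  \<open>pideal v (2 - \<lambda> ! i)\<close> in coordinate \<open>i\<close>.
\<close>

definition M_lam ::
    "('a::field \<Rightarrow> int) \<Rightarrow> ('a \<Rightarrow> 'r::comm_ring_1) \<Rightarrow> nat list \<Rightarrow> 'r vec set" where
  "M_lam v r2 lam =
     {w \<in> carrier_vec 4. \<forall>i<4. w $ i \<in> r2 ` pideal v (2 - int (lam ! i))}"

definition P_inf ::
    "('a::field \<Rightarrow> int) \<Rightarrow> ('a \<Rightarrow> 'r::comm_ring_1) \<Rightarrow> nat list \<Rightarrow> 'r mat set" where
  "P_inf v r2 lam =
     {g \<in> carrier (GL TYPE('r) 4). (\<lambda>w. g *\<^sub>v w) ` M_lam v r2 lam = M_lam v r2 lam}"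

definition U_inf ::
    "('a::field \<Rightarrow> int) \<Rightarrow> ('a \<Rightarrow> 'r::comm_ring_1) \<Rightarrow> nat list \<Rightarrow> 'r mat set" where
  "U_inf v r2 lam = {g \<in> P_inf v r2 lam. \<forall>w\<in>M_lam v r2 lam. g *\<^sub>v w = w}"

definition cuspidal ::
    "('a::field \<Rightarrow> int) \<Rightarrow> ('a \<Rightarrow> 'r::comm_ring_1) \<Rightarrow> nat \<Rightarrow> ('r mat \<Rightarrow> complex mat) \<Rightarrow> bool" where
  "cuspidal v r2 n \<pi> \<longleftrightarrow>
     irreducible_rep (GL TYPE('r) 4) n \<pi> \<and>
     (\<forall>\<chi> \<in> hom (units_of (class_ring :: 'r ring)) (units_of (class_ring :: complex ring)).
        (\<forall>(i, j) \<in> {(1, 3), (2, 2), (3, 1)}.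
           \<not> contains_trivial (U_geom i j) n (\<lambda>g. \<chi> (det g) \<cdot>\<^sub>m \<pi> g)) \<and>
        (\<forall>lam \<in> {[2, 1, 1, 1], [2, 2, 1, 1], [2, 2, 2, 1]}.
           \<not> contains_trivial (U_inf v r2 lam) n (\<lambda>g. \<chi> (det g) \<cdot>\<^sub>m \<pi> g)))"

end

theory Submission
  imports Defs
begin

text \<open>
  Write \<open>G\<close> for the general linear group over the ring of length two, \<open>K\<close> for the congruence subgroup,
  \<open>\<beta>\<close> for \<open>beta1\<close>, \<open>\<rho>\<close> for the character and \<open>S\<close> for the stabilizer from which \<open>\<pi>\<close> is induced, and
  \<open>w\<close> for the image of a uniformizer. The proof is Mackey's criterion done by hand.

  A vector of \<open>\<pi>\<close> fixed by a subset \<open>U\<close> of \<open>G\<close> is a non-zero function \<open>f\<close> on \<open>G\<close> that transforms under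
  \<open>S\<close> on the left by \<open>\<rho>\<close> and is invariant under \<open>U\<close> on the right. Suppose \<open>f\<close> does not vanish at \<open>g\<close>
  and \<open>U\<close> contains the elementary matrices with entry \<open>w t\<close>, for all \<open>t\<close>, at an off-diagonal place
  \<open>(i, j)\<close>. Conjugating these by \<open>g\<close> gives elements of \<open>K\<close> on which \<open>\<rho>\<close> must be trivial. Since \<open>\<rho>\<close> is
  \<open>\<psi>\<^sub>\<beta>\<close> on \<open>K\<close>, this forces the \<open>(j, i)\<close> entry of \<open>g\<^sup>-\<^sup>1 \<beta> g\<close> to vanish over the residue field
  (lemma \<open>conjugate_entry_zero\<close>). So a fixed vector makes \<open>\<beta>\<close> stabilize a subspace.

  For \<open>U\<close> of type \<open>(1, 3)\<close> the subspace is a line, and for type \<open>(3, 1)\<close> it is a hyperplane. Neither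
  exists, as the characteristic polynomial of \<open>\<beta>\<close> is the square of an irreducible quadratic
  (\<open>no_line_fixed\<close>, \<open>no_hyperplane_fixed\<close>). Each infinitesimal group contains the intersection of \<open>K\<close>
  with the group of type \<open>(3, 1)\<close>, so it falls under the same argument. All elementary matrices used
  have determinant one, hence a twist by a character of the determinant changes nothing.

  For type \<open>(2, 2)\<close> the subspace is a plane. The minimal polynomial of \<open>\<eta>\<close> is separable, so \<open>\<beta>\<close> is not
  semisimple and its only invariant plane is the standard one (\<open>invariant_plane\<close>). Then \<open>g\<close> is block
  triangular modulo \<open>w\<close>, and left multiplication by an element of \<open>K\<close>, which is contained in \<open>S\<close>, makes it
  exactly block triangular. Such a matrix normalizes \<open>U\<close>, so the value of \<open>f\<close> there is fixed
  by the intersection of \<open>S\<close> and \<open>U\<close> (\<open>plane_fixed_imp_trivial\<close>). Conversely, if that intersection acts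
  trivially through \<open>\<rho>\<close>, then \<open>\<rho>\<close> extends to a function supported on the product set \<open>S U\<close>, which is a
  fixed vector for \<open>U\<close> (\<open>function_supported_on_double_coset\<close>).
\<close>

section \<open>Fixed vectors in induced representations\<close>

lemma fixed_function_if_contains_trivial:
  assumes U: "U \<subseteq> carrier G" and iso: "iso_to_induced G n \<pi> H m \<rho>"
    and triv: "contains_trivial U n \<pi>"
  obtains f g where "f \<in> ind_space G H m \<rho>" "g \<in> carrier G" "f g \<noteq> 0\<^sub>v m"
    "\<And>x u. x \<in> carrier G \<Longrightarrow> u \<in> U \<Longrightarrow> f (x \<otimes>\<^bsub>G\<^esub> u) = f x"
proof -
  obtain T where bij: "bij_betw T (carrier_vec n) (ind_space G H m \<rho>)"
    and add: "\<And>u w. u \<in> carrier_vec n \<Longrightarrow> w \<in> carrier_vec n \<Longrightarrow> T (u + w) = (\<lambda>x. T u x + T w x)"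
    and smult: "\<And>c w. w \<in> carrier_vec n \<Longrightarrow> T (c \<cdot>\<^sub>v w) = (\<lambda>x. c \<cdot>\<^sub>v T w x)"
    and equiv: "\<And>g w x. g \<in> carrier G \<Longrightarrow> w \<in> carrier_vec n \<Longrightarrow> x \<in> carrier G \<Longrightarrow>
      T (\<pi> g *\<^sub>v w) x = T w (x \<otimes>\<^bsub>G\<^esub> g)"
    using iso unfolding iso_to_induced_def by auto
  obtain w where w: "w \<in> carrier_vec n" "w \<noteq> 0\<^sub>v n" and fixed: "\<And>u. u \<in> U \<Longrightarrow> \<pi> u *\<^sub>v w = w"
    using triv unfolding contains_char_def by auto
  have Tind: "T x \<in> ind_space G H m \<rho>" if "x \<in> carrier_vec n" for x
    using bij that by (auto simp: bij_betw_def)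
  have T0: "T (0\<^sub>v n) x = 0\<^sub>v m" for x
  proof (cases "x \<in> carrier G")
    case True
    then have c: "T w x \<in> carrier_vec m" using Tind[OF w(1)] by (auto simp: ind_space_def)
    have "T (0 \<cdot>\<^sub>v w) x = 0 \<cdot>\<^sub>v T w x" using smult[OF w(1), of 0] by simp
    moreover have "0 \<cdot>\<^sub>v w = 0\<^sub>v n" "0 \<cdot>\<^sub>v T w x = 0\<^sub>v m" using w(1) c by auto
    ultimately show ?thesis by simp
  qed (use Tind[of "0\<^sub>v n"] in \<open>auto simp: ind_space_def\<close>)
  have "T w \<noteq> T (0\<^sub>v n)" using bij w by (auto simp: bij_betw_def inj_on_def)
  then obtain g where g: "T w g \<noteq> 0\<^sub>v m" using T0 by (metis ext)
  then have gG: "g \<in> carrier G" using Tind[OF w(1)] by (auto simp: ind_space_def)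
  have "T w (x \<otimes>\<^bsub>G\<^esub> u) = T w x" if "x \<in> carrier G" "u \<in> U" for x u
    using equiv[of u w x] fixed[of u] U w that by auto
  with Tind[OF w(1)] gG g show ?thesis by (rule that)
qed

lemma contains_trivial_if_fixed_function:
  assumes U: "U \<subseteq> carrier G"
    and rep: "is_rep G n \<pi>" and iso: "iso_to_induced G n \<pi> H m \<rho>"
    and f: "f \<in> ind_space G H m \<rho>" and g: "f g \<noteq> 0\<^sub>v m"
    and inv: "\<And>x u. x \<in> carrier G \<Longrightarrow> u \<in> U \<Longrightarrow> f (x \<otimes>\<^bsub>G\<^esub> u) = f x"
  shows "contains_trivial U n \<pi>"
proof -
  obtain T where bij: "bij_betw T (carrier_vec n) (ind_space G H m \<rho>)"
    and smult: "\<And>c w. w \<in> carrier_vec n \<Longrightarrow> T (c \<cdot>\<^sub>v w) = (\<lambda>x. c \<cdot>\<^sub>v T w x)"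
    and equiv: "\<And>g w x. g \<in> carrier G \<Longrightarrow> w \<in> carrier_vec n \<Longrightarrow> x \<in> carrier G \<Longrightarrow>
      T (\<pi> g *\<^sub>v w) x = T w (x \<otimes>\<^bsub>G\<^esub> g)"
    using iso unfolding iso_to_induced_def by auto
  have "f \<in> T ` carrier_vec n"
    using bij_betw_imp_surj_on[OF bij] f by simp
  then obtain w where w: "w \<in> carrier_vec n" and Tw: "T w = f"
    by auto
  have Tind: "T x \<in> ind_space G H m \<rho>" if "x \<in> carrier_vec n" for x
    using bij that by (auto simp: bij_betw_def)
  have "w \<noteq> 0\<^sub>v n"
  proof
    assume w0: "w = 0\<^sub>v n"
    have gG: "g \<in> carrier G" using f g by (auto simp: ind_space_def)
    then have c: "f g \<in> carrier_vec m" using f by (auto simp: ind_space_def)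
    have "0 \<cdot>\<^sub>v w = w" using w0 by auto
    then have "f g = 0 \<cdot>\<^sub>v f g" using smult[OF w, of 0] Tw by metis
    moreover have "0 \<cdot>\<^sub>v f g = 0\<^sub>v m" using c by auto
    ultimately show False using g by simp
  qed
  moreover have "\<pi> u *\<^sub>v w = w" if u: "u \<in> U" for u
  proof -
    have uG: "u \<in> carrier G" using u U by auto
    have "\<pi> u \<in> carrier_mat n n"
      using rep uG by (auto simp: is_rep_def hom_def GL_def units_of_def Units_def ring_mat_def)
    then have c: "\<pi> u *\<^sub>v w \<in> carrier_vec n" using w by auto
    have "T (\<pi> u *\<^sub>v w) x = T w x" for x
    proof (cases "x \<in> carrier G")
      case True
      then show ?thesis using equiv[OF uG w True] inv[OF True u] Tw by simp
    next
      case False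
      then show ?thesis using Tind[OF w] Tind[OF c] by (auto simp: ind_space_def)
    qed
    then have "T (\<pi> u *\<^sub>v w) = T w" by auto
    then show ?thesis using bij c w by (auto simp: bij_betw_def inj_on_def)
  qed
  ultimately show ?thesis unfolding contains_char_def using w by auto
qed

text \<open>
  The converse direction of Mackey's criterion at the trivial double coset: a vector fixed by
  \<open>H \<inter> U\<close> gives a \<open>U\<close>-invariant function of the induced representation.
\<close>

lemma function_supported_on_double_coset:
  assumes "group G" and H: "subgroup H G" and U: "subgroup U G"
    and rep: "is_rep (G\<lparr>carrier := H\<rparr>) m \<rho>" and w: "w \<in> carrier_vec m"
    and fixed: "\<And>h. h \<in> H \<inter> U \<Longrightarrow> \<rho> h *\<^sub>v w = w"
  obtains f where "f \<in> ind_space G H m \<rho>" "f \<one>\<^bsub>G\<^esub> = w"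
    "\<And>x u. x \<in> carrier G \<Longrightarrow> u \<in> U \<Longrightarrow> f (x \<otimes>\<^bsub>G\<^esub> u) = f x"
proof -
  interpret group G by fact
  interpret H: subgroup H G by fact
  interpret U: subgroup U G by fact
  have rc: "\<rho> h \<in> carrier_mat m m" if "h \<in> H" for h
    using rep that by (auto simp: is_rep_def hom_def GL_def units_of_def Units_def ring_mat_def)
  have rm: "\<rho> (h \<otimes>\<^bsub>G\<^esub> k) = \<rho> h * \<rho> k" if "h \<in> H" "k \<in> H" for h k
    using rep that by (auto simp: is_rep_def hom_def GL_def units_of_def ring_mat_def)
  \<comment> \<open>The candidate is \<open>\<rho> h w\<close> at \<open>h u\<close>. Two ways of writing the same element differ by an element of
    \<open>H \<inter> U\<close>, which fixes \<open>w\<close>; so the choice made by \<open>SOME\<close> does not matter.\<close>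
  define f where "f x = (if \<exists>h\<in>H. \<exists>u\<in>U. x = h \<otimes>\<^bsub>G\<^esub> u
    then \<rho> (SOME h. h \<in> H \<and> (\<exists>u\<in>U. x = h \<otimes>\<^bsub>G\<^esub> u)) *\<^sub>v w else 0\<^sub>v m)" for x
  have f_eq: "f (h \<otimes>\<^bsub>G\<^esub> u) = \<rho> h *\<^sub>v w" if h: "h \<in> H" and u: "u \<in> U" for h u
  proof -
    define k where "k = (SOME k. k \<in> H \<and> (\<exists>v\<in>U. h \<otimes>\<^bsub>G\<^esub> u = k \<otimes>\<^bsub>G\<^esub> v))"
    have "\<exists>k. k \<in> H \<and> (\<exists>v\<in>U. h \<otimes>\<^bsub>G\<^esub> u = k \<otimes>\<^bsub>G\<^esub> v)" using h u by blast
    then have "k \<in> H \<and> (\<exists>v\<in>U. h \<otimes>\<^bsub>G\<^esub> u = k \<otimes>\<^bsub>G\<^esub> v)" unfolding k_def by (rule someI_ex)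
    then obtain v where k: "k \<in> H" and v: "v \<in> U" and eq: "h \<otimes>\<^bsub>G\<^esub> u = k \<otimes>\<^bsub>G\<^esub> v" by auto
    have G: "h \<in> carrier G" "k \<in> carrier G" "u \<in> carrier G" "v \<in> carrier G"
      using h k u v by auto
    have "inv\<^bsub>G\<^esub> k \<otimes>\<^bsub>G\<^esub> h = inv\<^bsub>G\<^esub> k \<otimes>\<^bsub>G\<^esub> (h \<otimes>\<^bsub>G\<^esub> u) \<otimes>\<^bsub>G\<^esub> inv\<^bsub>G\<^esub> u"
      using G by (simp add: m_assoc)
    also have "\<dots> = v \<otimes>\<^bsub>G\<^esub> inv\<^bsub>G\<^esub> u"
      unfolding eq using G by (simp add: m_assoc[symmetric])
    finally have "inv\<^bsub>G\<^esub> k \<otimes>\<^bsub>G\<^esub> h \<in> H \<inter> U" using h k u v by (metis H.m_closed H.m_inv_closed IntI U.m_closed U.m_inv_closed)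
    moreover have "\<rho> h = \<rho> k * \<rho> (inv\<^bsub>G\<^esub> k \<otimes>\<^bsub>G\<^esub> h)"
      using rm[of k "inv\<^bsub>G\<^esub> k \<otimes>\<^bsub>G\<^esub> h"] h k G by (simp add: m_assoc[symmetric])
    ultimately have "\<rho> h *\<^sub>v w = \<rho> k *\<^sub>v w"
      using fixed[of "inv\<^bsub>G\<^esub> k \<otimes>\<^bsub>G\<^esub> h"] rc[of k] rc[of "inv\<^bsub>G\<^esub> k \<otimes>\<^bsub>G\<^esub> h"] k w
      by (metis IntD1 assoc_mult_mat_vec)
    moreover have "f (h \<otimes>\<^bsub>G\<^esub> u) = \<rho> k *\<^sub>v w"
      unfolding f_def k_def using h u by auto
    ultimately show ?thesis by simp
  qed
  have f_off: "f x = 0\<^sub>v m" if "\<not> (\<exists>h\<in>H. \<exists>u\<in>U. x = h \<otimes>\<^bsub>G\<^esub> u)" for x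
    using that by (simp add: f_def)
  have shift: "(\<exists>h\<in>H. \<exists>v\<in>U. k \<otimes>\<^bsub>G\<^esub> x \<otimes>\<^bsub>G\<^esub> u = h \<otimes>\<^bsub>G\<^esub> v) \<Longrightarrow> (\<exists>h\<in>H. \<exists>v\<in>U. x = h \<otimes>\<^bsub>G\<^esub> v)"
    if x: "x \<in> carrier G" and k: "k \<in> H" and u: "u \<in> U" for x k u
  proof -
    assume "\<exists>h\<in>H. \<exists>v\<in>U. k \<otimes>\<^bsub>G\<^esub> x \<otimes>\<^bsub>G\<^esub> u = h \<otimes>\<^bsub>G\<^esub> v"
    then obtain h v where h: "h \<in> H" and v: "v \<in> U" and eq: "k \<otimes>\<^bsub>G\<^esub> x \<otimes>\<^bsub>G\<^esub> u = h \<otimes>\<^bsub>G\<^esub> v" by auto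
    have G: "h \<in> carrier G" "k \<in> carrier G" "u \<in> carrier G" "v \<in> carrier G"
      using h k u v by auto
    have "x = inv\<^bsub>G\<^esub> k \<otimes>\<^bsub>G\<^esub> (k \<otimes>\<^bsub>G\<^esub> x \<otimes>\<^bsub>G\<^esub> u) \<otimes>\<^bsub>G\<^esub> inv\<^bsub>G\<^esub> u"
      using G x by (simp add: m_assoc inv_solve_left)
    also have "\<dots> = (inv\<^bsub>G\<^esub> k \<otimes>\<^bsub>G\<^esub> h) \<otimes>\<^bsub>G\<^esub> (v \<otimes>\<^bsub>G\<^esub> inv\<^bsub>G\<^esub> u)"
      unfolding eq using G by (simp add: m_assoc)
    finally show ?thesis using h k u v by (metis H.m_closed H.m_inv_closed U.m_closed U.m_inv_closed)
  qed
  show ?thesis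
  proof (rule that)
    show "f \<one>\<^bsub>G\<^esub> = w"
    proof -
      have "\<rho> \<one>\<^bsub>G\<^esub> *\<^sub>v w = w" by (rule fixed) auto
      then show ?thesis using f_eq[of "\<one>\<^bsub>G\<^esub>" "\<one>\<^bsub>G\<^esub>"] by simp
    qed
    show "f (x \<otimes>\<^bsub>G\<^esub> u) = f x" if x: "x \<in> carrier G" and u: "u \<in> U" for x u
    proof (cases "\<exists>h\<in>H. \<exists>v\<in>U. x = h \<otimes>\<^bsub>G\<^esub> v")
      case True
      then obtain h v where hv: "h \<in> H" "v \<in> U" "x = h \<otimes>\<^bsub>G\<^esub> v" by auto
      then have "x \<otimes>\<^bsub>G\<^esub> u = h \<otimes>\<^bsub>G\<^esub> (v \<otimes>\<^bsub>G\<^esub> u)" using u by (simp add: m_assoc)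
      then show ?thesis using f_eq[of h v] f_eq[of h "v \<otimes>\<^bsub>G\<^esub> u"] hv u by simp
    next
      case False
      then have "\<not> (\<exists>h\<in>H. \<exists>v\<in>U. x \<otimes>\<^bsub>G\<^esub> u = h \<otimes>\<^bsub>G\<^esub> v)"
        using shift[OF x H.one_closed u] x by auto
      then show ?thesis using False f_off by metis
    qed
    show "f \<in> ind_space G H m \<rho>"
      unfolding ind_space_def
    proof (intro CollectI conjI ballI allI impI)
      show "f x \<in> carrier_vec m" if "x \<in> carrier G" for x
      proof (cases "\<exists>h\<in>H. \<exists>u\<in>U. x = h \<otimes>\<^bsub>G\<^esub> u")
        case True
        then obtain h u where "h \<in> H" "u \<in> U" "x = h \<otimes>\<^bsub>G\<^esub> u" by auto
        then show ?thesis using f_eq[of h u] rc[of h] w by simp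
      qed (simp add: f_off)
      show "f x = 0\<^sub>v m" if "x \<notin> carrier G" for x
        using that by (intro f_off) auto
      show "f (k \<otimes>\<^bsub>G\<^esub> x) = \<rho> k *\<^sub>v f x" if k: "k \<in> H" and x: "x \<in> carrier G" for k x
      proof (cases "\<exists>h\<in>H. \<exists>u\<in>U. x = h \<otimes>\<^bsub>G\<^esub> u")
        case True
        then obtain h u where hu: "h \<in> H" "u \<in> U" "x = h \<otimes>\<^bsub>G\<^esub> u" by auto
        then have "k \<otimes>\<^bsub>G\<^esub> x = (k \<otimes>\<^bsub>G\<^esub> h) \<otimes>\<^bsub>G\<^esub> u" using k by (simp add: m_assoc)
        then show ?thesis using f_eq[of h u] f_eq[of "k \<otimes>\<^bsub>G\<^esub> h" u] hu k rm[of k h] rc[of k] rc[of h] w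
          by simp
      next
        case False
        then have "\<not> (\<exists>h\<in>H. \<exists>u\<in>U. k \<otimes>\<^bsub>G\<^esub> x = h \<otimes>\<^bsub>G\<^esub> u)"
          using shift[OF x k U.one_closed] x k by auto
        then show ?thesis using False f_off rc[OF k] by auto
      qed
    qed
  qed
qed

section \<open>General linear groups and elementary matrices\<close>

lemma group_GL: "group (GL TYPE('a::comm_ring_1) n)"
proof -
  interpret R: ring "ring_mat TYPE('a) n ()" by (rule ring_mat)
  show ?thesis unfolding GL_def by (rule R.units_group)
qed

lemma GL_simps [simp]:
  "mult (GL TYPE('a::comm_ring_1) n) = (*)" "one (GL TYPE('a) n) = 1\<^sub>m n"
  by (simp_all add: GL_def units_of_def ring_mat_simps)

lemma GL_carrier_iff:
  "A \<in> carrier (GL TYPE('a::comm_ring_1) n) \<longleftrightarrow>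
     A \<in> carrier_mat n n \<and> (\<exists>B\<in>carrier_mat n n. B * A = 1\<^sub>m n \<and> A * B = 1\<^sub>m n)"
  by (auto simp: GL_def units_of_def Units_def ring_mat_simps)

lemma GL_inv:
  assumes "A \<in> carrier (GL TYPE('a::comm_ring_1) n)"
  shows "inv\<^bsub>GL TYPE('a) n\<^esub> A \<in> carrier_mat n n"
    "inv\<^bsub>GL TYPE('a) n\<^esub> A * A = 1\<^sub>m n" "A * inv\<^bsub>GL TYPE('a) n\<^esub> A = 1\<^sub>m n"
  using group.inv_closed[OF group_GL assms] group.l_inv[OF group_GL assms]
    group.r_inv[OF group_GL assms] by (simp_all add: GL_carrier_iff)

lemma elementary_in_GL:
  assumes "i \<noteq> j" "i < n" "j < n"
  shows "addrow_mat n c i j \<in> carrier (GL TYPE('a::comm_ring_1) n)"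
  unfolding GL_carrier_iff
  by (intro conjI bexI[of _ "addrow_mat n (- c) i j"])
    (use addrow_mat_inv[of i n j c] addrow_mat_inv[of i n j "- c"] assms in auto)

lemma mat_trace_mult:
  assumes "A \<in> carrier_mat n m" "B \<in> carrier_mat m n"
  shows "mat_trace (A * B) = (\<Sum>i<n. \<Sum>k<m. A $$ (i, k) * (B $$ (k, i) :: 'a::comm_semiring_0))"
  using assms by (auto simp: mat_trace_def scalar_prod_def lessThan_atLeast0 intro!: sum.cong)

lemma mat_trace_commute:
  assumes "A \<in> carrier_mat n m" "B \<in> carrier_mat m n"
  shows "mat_trace (A * B) = mat_trace (B * (A :: 'a::comm_semiring_0 mat))"
  unfolding mat_trace_mult[OF assms] mat_trace_mult[OF assms(2,1)]
  by (subst sum.swap) (simp add: mult.commute)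

text \<open>
  The trace pairing with elementary matrices reads off single entries, at the transposed place.
\<close>

lemma mat_trace_mult_elementary:
  fixes Y :: "'a::comm_ring_1 mat"
  assumes Y: "Y \<in> carrier_mat n n" and ij: "i \<noteq> j" "i < n" "j < n"
  shows "mat_trace (Y * (addrow_mat n c i j - 1\<^sub>m n)) = c * Y $$ (j, i)"
proof -
  have "mat_trace (Y * (addrow_mat n c i j - 1\<^sub>m n)) =
      (\<Sum>p<n. \<Sum>k<n. Y $$ (p, k) * (addrow_mat n c i j - 1\<^sub>m n) $$ (k, p))"
    by (rule mat_trace_mult[OF Y]) auto
  also have "\<dots> = (\<Sum>p<n. \<Sum>k<n. if k = i then if p = j then Y $$ (j, i) * c else 0 else 0)"
    using ij by (intro sum.cong) auto
  also have "\<dots> = c * Y $$ (j, i)"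
    using ij by (simp add: mult.commute)
  finally show ?thesis .
qed


section \<open>Block unipotent groups\<close>

lemma U_geom_mult:
  assumes "B \<in> carrier_mat i j" "C \<in> carrier_mat i j"
  shows "four_block_mat (1\<^sub>m i) B (0\<^sub>m j i) (1\<^sub>m j) * four_block_mat (1\<^sub>m i) C (0\<^sub>m j i) (1\<^sub>m j)
    = four_block_mat (1\<^sub>m i) (B + C) (0\<^sub>m j i) (1\<^sub>m j :: 'r::comm_ring_1 mat)"
  using assms
  by (subst mult_four_block_mat[of _ i i _ j _ j _ _ i _ j])
    (auto simp: comm_add_mat[of C i j B])

lemma one_four_block: "four_block_mat (1\<^sub>m i) (0\<^sub>m i j) (0\<^sub>m j i) (1\<^sub>m j) = (1\<^sub>m (i + j) :: 'r::comm_ring_1 mat)"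
  by (rule eq_matI) auto

lemma U_geom_subgroup: "subgroup (U_geom i j) (GL TYPE('r::comm_ring_1) (i + j))"
proof -
  let ?G = "GL TYPE('r) (i + j)"
  let ?u = "\<lambda>B :: 'r mat. four_block_mat (1\<^sub>m i) B (0\<^sub>m j i) (1\<^sub>m j)"
  interpret group ?G by (rule group_GL)
  have inv: "?u (- B) * ?u B = 1\<^sub>m (i + j)" "?u B * ?u (- B) = 1\<^sub>m (i + j)" if B: "B \<in> carrier_mat i j" for B
    using B by (simp_all add: U_geom_mult one_four_block uminus_l_inv_mat[of _ i j] comm_add_mat[of B i j "- B"])
  have carrier: "?u B \<in> carrier ?G" if B: "B \<in> carrier_mat i j" for B
    unfolding GL_carrier_iff using inv[OF B] B by (intro conjI bexI[of _ "?u (- B)"]) auto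
  show ?thesis
  proof (rule subgroupI)
    show "U_geom i j \<subseteq> carrier ?G" using carrier by (auto simp: U_geom_def)
    show "U_geom i j \<noteq> ({} :: 'r mat set)" unfolding U_geom_def using zero_carrier_mat by blast
  next
    fix a :: "'r mat" assume "a \<in> U_geom i j"
    then obtain B where B: "B \<in> carrier_mat i j" and a: "a = ?u B" by (auto simp: U_geom_def)
    have mB: "- B \<in> carrier_mat i j" using B by simp
    have "inv\<^bsub>?G\<^esub> a = ?u (- B)"
      using inv[OF B] carrier[OF B] carrier[OF mB] unfolding a by (intro inv_equality) auto
    then show "inv\<^bsub>?G\<^esub> a \<in> U_geom i j" using mB by (auto simp: U_geom_def)
  next
    fix a b :: "'r mat" assume "a \<in> U_geom i j" "b \<in> U_geom i j"
    then obtain B C where "B \<in> carrier_mat i j" "a = ?u B" "C \<in> carrier_mat i j" "b = ?u C"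
      by (auto simp: U_geom_def)
    then show "a \<otimes>\<^bsub>?G\<^esub> b \<in> U_geom i j"
      using U_geom_mult[of B i j C] by (auto simp: U_geom_def intro!: exI[of _ "B + C"])
  qed
qed

lemma elementary_in_U_geom:
  assumes "p < i" "i \<le> q" "q < i + j"
  shows "addrow_mat (i + j) c p q \<in> U_geom i (j::nat)"
proof -
  have "addrow_mat (i + j) c p q =
      four_block_mat (1\<^sub>m i) (mat i j (\<lambda>(a, b). if a = p \<and> b = q - i then c else 0)) (0\<^sub>m j i) (1\<^sub>m j)"
    using assms by (intro eq_matI) auto
  then show ?thesis unfolding U_geom_def by (intro CollectI exI conjI) auto
qed

lemma det_U_geom: "u \<in> U_geom i j \<Longrightarrow> det (u :: 'r::comm_ring_1 mat) = 1"
proof -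
  assume "u \<in> U_geom i j"
  then obtain B where B: "B \<in> carrier_mat i j" and u: "u = four_block_mat (1\<^sub>m i) B (0\<^sub>m j i) (1\<^sub>m j)"
    by (auto simp: U_geom_def)
  have "det u = prod_list (diag_mat u)"
    using B by (intro det_upper_triangular[of _ "i + j"] upper_triangularI) (auto simp: u)
  also have "\<dots> = 1"
    unfolding prod_list_diag_prod using B by (intro prod.neutral) (auto simp: u)
  finally show ?thesis .
qed

text \<open>
  Conjugation by a block triangular matrix multiplies the upper right block of a unipotent matrix by
  the diagonal blocks. Only the inverse of the first diagonal block enters the formula for \<open>u'\<close>.
\<close>

lemma U_geom_conjugate:
  assumes u: "u \<in> U_geom i j"
    and P: "P \<in> carrier_mat i i" and L: "L \<in> carrier_mat i i" and PL: "P * L = 1\<^sub>m i"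
    and Q: "Q \<in> carrier_mat i j" and S: "S \<in> carrier_mat j j"
  defines "g \<equiv> four_block_mat P Q (0\<^sub>m j i) (S :: 'r::comm_ring_1 mat)"
  obtains u' where "u' \<in> U_geom i j" "u * g = g * u'"
proof -
  obtain B where B: "B \<in> carrier_mat i j" and u: "u = four_block_mat (1\<^sub>m i) B (0\<^sub>m j i) (1\<^sub>m j)"
    using u by (auto simp: U_geom_def)
  let ?C = "L * (B * S)"
  have C: "?C \<in> carrier_mat i j" using L B S by auto
  have PC: "P * ?C = B * S"
    using assoc_mult_mat[OF P L, of "B * S" j] B S PL by simp
  have "u * g = four_block_mat P (Q + B * S) (0\<^sub>m j i) S"
    unfolding u g_def mult_four_block_mat[OF one_carrier_mat B zero_carrier_mat one_carrier_mat P Q zero_carrier_mat S]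
    using P Q S B by simp
  moreover have "g * four_block_mat (1\<^sub>m i) ?C (0\<^sub>m j i) (1\<^sub>m j) = four_block_mat P (B * S + Q) (0\<^sub>m j i) S"
    unfolding g_def mult_four_block_mat[OF P Q zero_carrier_mat S one_carrier_mat C zero_carrier_mat one_carrier_mat] PC
    using P Q S left_mult_zero_mat[OF C] by simp
  moreover have "Q + B * S = B * S + Q" using Q B S by (intro comm_add_mat) auto
  ultimately show ?thesis using C by (intro that[of "four_block_mat (1\<^sub>m i) ?C (0\<^sub>m j i) (1\<^sub>m j)"]) (auto simp: U_geom_def)
qed


section \<open>Invariant subspaces of beta over the residue field\<close>

text \<open>
  This is \<open>beta1\<close> when \<open>\<eta>\<close> is a root of \<open>X\<^sup>2 - b X - a\<close>: the companion matrix of the quadratic in both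
  diagonal blocks and the identity in the upper right block.
\<close>

definition jordan_companion :: "'k::field \<Rightarrow> 'k \<Rightarrow> 'k mat" where
  "jordan_companion a b =
     mat_of_rows_list 4 [[0, a, 1, 0], [1, b, 0, 1], [0, 0, 0, a], [0, 0, 1, b]]"

lemma jordan_companion_carrier [simp]: "jordan_companion a b \<in> carrier_mat 4 4"
  by (rule carrier_matI) (simp_all add: jordan_companion_def mat_of_rows_list_def)

lemma sum_lessThan_4: "(\<Sum>i<(4::nat). f i) = f 0 + f 1 + f 2 + (f 3 :: 'a::comm_monoid_add)"
  by (simp add: eval_nat_numeral ac_simps)

lemma mult_mat_4_entry:
  assumes "A \<in> carrier_mat 4 4" "B \<in> carrier_mat 4 4" "i < 4" "j < 4"
  shows "(A * B) $$ (i, j) = A $$ (i, 0) * B $$ (0, j) + A $$ (i, 1) * B $$ (1, j)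
    + A $$ (i, 2) * B $$ (2, j) + A $$ (i, 3) * (B $$ (3, j) :: 'a::comm_semiring_0)"
proof -
  have "(A * B) $$ (i, j) = (\<Sum>k<4. A $$ (i, k) * B $$ (k, j))"
    using assms by (auto simp: scalar_prod_def lessThan_atLeast0 intro!: sum.cong)
  then show ?thesis by (simp only: sum_lessThan_4)
qed

lemma jordan_companion_mult_entries:
  assumes "g \<in> carrier_mat 4 4" "j < 4"
  shows "(jordan_companion a b * g) $$ (0, j) = a * g $$ (1, j) + g $$ (2, j)"
    and "(jordan_companion a b * g) $$ (1, j) = g $$ (0, j) + b * g $$ (1, j) + g $$ (3, j)"
    and "(jordan_companion a b * g) $$ (2, j) = a * g $$ (3, j)"
    and "(jordan_companion a b * g) $$ (3, j) = g $$ (2, j) + b * g $$ (3, j)"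
  by (simp_all add: mult_mat_4_entry[OF jordan_companion_carrier assms(1) _ assms(2)])
    (simp_all add: jordan_companion_def mat_of_rows_list_def)

lemma mult_jordan_companion_entries:
  assumes "g \<in> carrier_mat 4 4" "i < 4"
  shows "(g * jordan_companion a b) $$ (i, 0) = g $$ (i, 1)"
    and "(g * jordan_companion a b) $$ (i, 1) = a * g $$ (i, 0) + b * g $$ (i, 1)"
    and "(g * jordan_companion a b) $$ (i, 2) = g $$ (i, 0) + g $$ (i, 3)"
    and "(g * jordan_companion a b) $$ (i, 3) = g $$ (i, 1) + a * g $$ (i, 2) + b * g $$ (i, 3)"
  by (simp_all add: mult_mat_4_entry[OF assms(1) jordan_companion_carrier assms(2)])
    (simp_all add: jordan_companion_def mat_of_rows_list_def mult.commute)

text \<open>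
  The number \<open>b * b + 4 * a\<close> is the discriminant of \<open>X\<^sup>2 - b X - a\<close>.
\<close>

locale irreducible_quadratic =
  fixes a b :: "'k::field"
  assumes no_root: "t * t \<noteq> b * t + a"
    and separable: "b * b + 4 * a \<noteq> 0"
begin

lemma companion_no_eigenvector:
  assumes 1: "a * y = c * x" and 2: "x + b * y = c * y"
  shows "x = 0" "y = 0"
proof -
  have x: "x = (c - b) * y" using 2 by (simp add: algebra_simps)
  have "(c * c - b * c - a) * y = 0" using 1 unfolding x by (simp add: algebra_simps)
  moreover have "c * c - b * c - a \<noteq> 0" using no_root[of c] by (simp add: algebra_simps)
  ultimately show "y = 0" by simp
  then show "x = 0" using x by simp
qed

lemma companion_no_left_eigenvector:
  assumes 1: "y = c * x" and 2: "a * x + b * y = c * y"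
  shows "x = 0" "y = 0"
proof -
  have "(c * c - b * c - a) * x = 0" using 2 unfolding 1 by (simp add: algebra_simps)
  moreover have "c * c - b * c - a \<noteq> 0" using no_root[of c] by (simp add: algebra_simps)
  ultimately show "x = 0" by simp
  then show "y = 0" using 1 by simp
qed

text \<open>
  Let \<open>\<beta>\<close> be the Jordan companion matrix and \<open>p = (p0, p1, r0, r1)\<close> a vector; \<open>(y0, y1, s0, s1)\<close> is
  \<open>\<beta> p\<close>, and the last four hypotheses say that \<open>\<beta>\<^sup>2 p = T \<beta> p - D p\<close>.
  On the lower half \<open>(r0, r1)\<close> the operator \<open>\<beta>\<close>
  acts as the companion matrix \<open>C\<close>. If \<open>X\<^sup>2 - T X + D\<close> differs from the irreducible quadratic \<open>m\<close>, it
  therefore acts there as a non-zero polynomial in \<open>C\<close> of degree at most one, which is invertible because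
  \<open>C\<close> has no eigenvalue. If it equals \<open>m\<close>, then the upper half of \<open>m(\<beta>) p\<close> is
  \<open>m'(C)\<close> applied to \<open>(r0, r1)\<close>, and \<open>m'(C) = 2 C - b\<close> is invertible, its
  square being the discriminant.
\<close>

lemma kernel_of_quadratic:
  assumes y0: "y0 = a * p1 + r0" and y1: "y1 = p0 + b * p1 + r1"
    and s0: "s0 = a * r1" and s1: "s1 = r0 + b * r1"
    and top0: "a * y1 + s0 = T * y0 - D * p0"
    and top1: "y0 + b * y1 + s1 = T * y1 - D * p1"
    and bot0: "a * s1 = T * s0 - D * r0"
    and bot1: "s0 + b * s1 = T * s1 - D * r1"
  shows "r0 = 0 \<and> r1 = 0"
proof -
  have e0: "(a + D) * r0 + (b - T) * (a * r1) = 0"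
    using bot0 unfolding s0 s1 by (simp add: algebra_simps)
  have e1: "(b - T) * r0 + ((a + D) + (b - T) * b) * r1 = 0"
    using bot1 unfolding s0 s1 by (simp add: algebra_simps)
  show ?thesis
  proof (cases "b = T")
    case False
    define c where "c = - (a + D) / (b - T)"
    have aD: "a + D = - c * (b - T)" using False by (simp add: c_def)
    have "(b - T) * (a * r1 - c * r0) = 0" using e0 unfolding aD by (simp add: algebra_simps)
    moreover have "(b - T) * (r0 + b * r1 - c * r1) = 0" using e1 unfolding aD by (simp add: algebra_simps)
    ultimately have "a * r1 = c * r0" "r0 + b * r1 = c * r1" using False by simp_all
    then show ?thesis using companion_no_eigenvector by blast
  next
    case True
    show ?thesis
    proof (cases "a + D = 0")
      case False
      then show ?thesis using e0 e1 True by simp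
    next
      case aD: True
      then have D: "D = - a" by (simp add: eq_neg_iff_add_eq_0 add.commute)
      have f0: "2 * a * r1 = b * r0"
        using top0 unfolding y0 y1 s0 D True[symmetric] by (simp add: algebra_simps)
      have f1: "2 * r0 + b * r1 = 0"
        using top1 unfolding y0 y1 s1 D True[symmetric] by (simp add: algebra_simps)
      have "(b * b + 4 * a) * r0 = 2 * a * (2 * r0 + b * r1) - b * (2 * a * r1 - b * r0)"
        by (simp add: algebra_simps)
      then have "(b * b + 4 * a) * r0 = 0" using f0 f1 by simp
      moreover have "(b * b + 4 * a) * r1 = b * (2 * r0 + b * r1) + 2 * (2 * a * r1 - b * r0)"
        by (simp add: algebra_simps)
      then have "(b * b + 4 * a) * r1 = 0" using f0 f1 by simp
      ultimately show ?thesis using separable by simp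
    qed
  qed
qed

text \<open>
  The lower half of such a column satisfies the eigenvector equation of the companion matrix, so it
  vanishes; after that the upper half satisfies the same equation.
\<close>

lemma eigen_column_zero:
  assumes g: "g \<in> carrier_mat 4 4" and j: "j < 4"
    and eig: "\<And>i. i < 4 \<Longrightarrow> (jordan_companion a b * g) $$ (i, j) = c * g $$ (i, j)"
    and i: "i < 4"
  shows "g $$ (i, j) = 0"
proof -
  note e = jordan_companion_mult_entries[OF g j, of a b]
  have bot: "g $$ (2, j) = 0" "g $$ (3, j) = 0"
    using companion_no_eigenvector[of "g $$ (3, j)" c "g $$ (2, j)"] eig[of 2] eig[of 3] e by auto
  have "g $$ (0, j) = 0" "g $$ (1, j) = 0"
    using companion_no_eigenvector[of "g $$ (1, j)" c "g $$ (0, j)"] eig[of 0] eig[of 1] e bot by auto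
  with bot i show ?thesis by (auto simp: less_Suc_eq eval_nat_numeral)
qed

lemma eigen_row_zero:
  assumes g: "g \<in> carrier_mat 4 4" and i: "i < 4"
    and eig: "\<And>j. j < 4 \<Longrightarrow> (g * jordan_companion a b) $$ (i, j) = c * g $$ (i, j)"
    and j: "j < 4"
  shows "g $$ (i, j) = 0"
proof -
  note e = mult_jordan_companion_entries[OF g i, of a b]
  have top: "g $$ (i, 0) = 0" "g $$ (i, 1) = 0"
    using companion_no_left_eigenvector[of "g $$ (i, 1)" c "g $$ (i, 0)"] eig[of 0] eig[of 1] e
    by auto
  have "g $$ (i, 2) = 0" "g $$ (i, 3) = 0"
    using companion_no_left_eigenvector[of "g $$ (i, 3)" c "g $$ (i, 2)"] eig[of 2] eig[of 3] e top
    by auto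
  with top j show ?thesis by (auto simp: less_Suc_eq eval_nat_numeral)
qed

text \<open>
  If the first two columns of \<open>g\<close> span an invariant plane, that plane is the standard one. For
  invertible \<open>g\<close> this says that the Jordan companion matrix has a single invariant plane.
\<close>

lemma invariant_plane:
  assumes g: "g \<in> carrier_mat 4 4" and y: "y \<in> carrier_mat 4 4"
    and eq: "jordan_companion a b * g = g * y"
    and low: "\<And>i j. i \<in> {2, 3} \<Longrightarrow> j \<in> {0, 1} \<Longrightarrow> y $$ (i, j) = 0"
    and i: "i \<in> {2, 3}" and j: "j \<in> {0, 1}"
  shows "g $$ (i, j) = 0"
proof -
  let ?B = "jordan_companion a b"
  have B: "(?B * g) $$ (p, q) = g $$ (p, 0) * y $$ (0, q) + g $$ (p, 1) * y $$ (1, q)"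
    if "p < 4" "q < 2" for p q
  proof -
    have "q \<in> {0, 1}" using that by auto
    then show ?thesis
      unfolding eq using mult_mat_4_entry[OF g y \<open>p < 4\<close>, of q] low[of 2 q] low[of 3 q] by auto
  qed
  \<comment> \<open>Let \<open>T\<close> and \<open>D\<close> be the trace and determinant of beta on the plane. By the Cayley--Hamilton
    theorem beta squared is \<open>T\<close> times beta minus \<open>D\<close> there.\<close>
  define T where "T = y $$ (0, 0) + y $$ (1, 1)"
  define D where "D = y $$ (0, 0) * y $$ (1, 1) - y $$ (0, 1) * y $$ (1, 0)"
  have Bg: "?B * g \<in> carrier_mat 4 4" using g by (meson jordan_companion_carrier mult_carrier_mat)
  have CH: "(?B * (?B * g)) $$ (p, q) = T * (?B * g) $$ (p, q) - D * g $$ (p, q)"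
    if p: "p < 4" and q: "q < 2" for p q
  proof -
    have "?B * (?B * g) = (?B * g) * y"
      using eq g y by (metis assoc_mult_mat jordan_companion_carrier)
    moreover have q01: "q = 0 \<or> q = 1" using q by auto
    ultimately have "(?B * (?B * g)) $$ (p, q) =
        (?B * g) $$ (p, 0) * y $$ (0, q) + (?B * g) $$ (p, 1) * y $$ (1, q)"
      using mult_mat_4_entry[OF Bg y p, of q] q low[of 2 q] low[of 3 q] by auto
    then show ?thesis
      using q01 B[OF p, of 0] B[OF p, of 1] by (auto simp: T_def D_def algebra_simps)
  qed
  have j2: "j < 2" "j < 4" using j by auto
  note e = jordan_companion_mult_entries[OF g j2(2), of a b]
  note e2 = jordan_companion_mult_entries[OF Bg j2(2), of a b]
  have "g $$ (2, j) = 0 \<and> g $$ (3, j) = 0"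
    by (rule kernel_of_quadratic[OF e, of T D])
      (use e2 CH[OF _ j2(1), of 0] CH[OF _ j2(1), of 1] CH[OF _ j2(1), of 2] CH[OF _ j2(1), of 3]
        in simp_all)
  then show ?thesis using i by auto
qed

end

text \<open>
  The discriminant does not vanish because finite fields are perfect: in odd characteristic a zero
  discriminant gives the root \<open>b / 2\<close>, and in characteristic two it gives \<open>b = 0\<close>, while \<open>a\<close> is a square.
\<close>

lemma quadratic_generator:
  fixes \<iota> :: "'k::field \<Rightarrow> 'l::field"
  assumes hom: "comm_ring_hom \<iota>" and fin: "finite (UNIV :: 'k set)"
    and card: "card (UNIV :: 'l set) = card (UNIV :: 'k set) ^ 2"
    and gen: "generates_over \<iota> \<eta>"
  obtains a b where "irreducible_quadratic a b" "beta1 \<iota> \<eta> = jordan_companion a b"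
proof -
  interpret comm_ring_hom \<iota> by fact
  have hom_inv: "\<iota> (inverse x) = inverse (\<iota> x)" for x
  proof (cases "x = 0")
    case False
    then have "\<iota> x * \<iota> (inverse x) = 1" by (metis hom_mult hom_one right_inverse)
    then show ?thesis by (metis inverse_unique)
  qed simp
  have inj0: "x = 0" if "\<iota> x = 0" for x
  proof (rule ccontr)
    assume "x \<noteq> 0"
    then have "\<iota> x * \<iota> (inverse x) = 1" by (metis hom_mult hom_one right_inverse)
    then show False using that by simp
  qed
  have inj: "x = y" if "\<iota> x = \<iota> y" for x y using inj0[of "x - y"] that by (simp add: hom_minus)
  let ?q = "card (UNIV :: 'k set)"
  have "card {0, 1 :: 'k} \<le> ?q" by (rule card_mono[OF fin]) simp
  then have q: "?q \<ge> 2" by simp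
  then have finl: "finite (UNIV :: 'l set)" using card by (intro card_ge_0_finite) simp
  have eta: "\<eta> \<notin> range \<iota>"
  proof
    assume "\<eta> \<in> range \<iota>"
    moreover have "\<forall>x\<in>range \<iota>. \<forall>y\<in>range \<iota>. x - y \<in> range \<iota> \<and> x * y \<in> range \<iota> \<and> inverse x \<in> range \<iota>"
      using hom_minus hom_mult hom_inv by (auto simp: image_iff) metis+
    ultimately have "range \<iota> = UNIV" using gen unfolding generates_over_def by blast
    then have "card (UNIV :: 'l set) \<le> ?q" using card_image_le[OF fin, of \<iota>] by simp
    then have "?q * ?q \<le> ?q" using card by (simp add: power2_eq_square)
    then show False using q by simp
  qed
  define ev where "ev = (\<lambda>(x, y). \<iota> x + \<iota> y * \<eta>)"
  have "inj ev"
  proof (rule injI, clarify)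
    fix x y x' y' assume "ev (x, y) = ev (x', y')"
    then have e: "\<iota> (y - y') * \<eta> = \<iota> (x' - x)"
      by (simp add: ev_def hom_minus algebra_simps)
    have "y = y'"
    proof (rule ccontr)
      assume "y \<noteq> y'"
      then have "\<iota> (y - y') \<noteq> 0" using inj0[of "y - y'"] by auto
      then have "\<eta> = \<iota> (x' - x) * inverse (\<iota> (y - y'))" using e by (simp add: field_simps)
      then have "\<eta> = \<iota> ((x' - x) * inverse (y - y'))" by (simp only: hom_mult hom_inv)
      then show False using eta by blast
    qed
    then show "x = x' \<and> y = y'" using e inj0[of "x' - x"] by auto
  qed
  moreover have "card (UNIV :: ('k \<times> 'k) set) = card (UNIV :: 'l set)"
    using card by (simp add: power2_eq_square card_cartesian_product flip: UNIV_Times_UNIV)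
  moreover have "finite (UNIV :: ('k \<times> 'k) set)" using fin by (simp add: finite_prod)
  ultimately have "range ev = UNIV"
    using finl by (intro card_subset_eq) (auto simp: card_image)
  then have "\<eta> * \<eta> \<in> range ev" by simp
  then obtain a b where ab: "\<eta> * \<eta> = \<iota> a + \<iota> b * \<eta>" by (auto simp: ev_def)
  have coords: "coords \<iota> \<eta> (\<iota> x + \<iota> y * \<eta>) = vec 2 (\<lambda>i. if i = 0 then x else y)" for x y
    unfolding coords_def
  proof (rule the_equality)
    show "vec 2 (\<lambda>i. if i = 0 then x else y) \<in> carrier_vec 2 \<and>
        \<iota> x + \<iota> y * \<eta> = \<iota> (vec 2 (\<lambda>i. if i = 0 then x else y) $ 0) + \<iota> (vec 2 (\<lambda>i. if i = 0 then x else y) $ 1) * \<eta>"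
      by simp
  next
    fix c :: "'k vec" assume c: "c \<in> carrier_vec 2 \<and> \<iota> x + \<iota> y * \<eta> = \<iota> (c $ 0) + \<iota> (c $ 1) * \<eta>"
    then have "ev (x, y) = ev (c $ 0, c $ 1)" by (simp add: ev_def)
    then have "c $ 0 = x" "c $ 1 = y" using \<open>inj ev\<close> by (auto dest: injD)
    then show "c = vec 2 (\<lambda>i. if i = 0 then x else y)"
      using c by (intro eq_vecI) (auto dest: less_2_cases)
  qed
  \<comment> \<open>If \<open>t\<close> were a root, then \<open>X\<^sup>2 - b X - a\<close> would split as \<open>(X - t) (X - (b - t))\<close> over the small
    field, which would contain \<open>\<eta>\<close>.\<close>
  have no_root: "t * t \<noteq> b * t + a" for t
  proof
    assume "t * t = b * t + a"
    then have a: "a = t * t - b * t" by simp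
    have "(\<eta> - \<iota> t) * (\<eta> - \<iota> (b - t)) = \<eta> * \<eta> - \<iota> b * \<eta> - \<iota> a"
      unfolding a by (simp add: hom_minus hom_mult algebra_simps)
    then have "(\<eta> - \<iota> t) * (\<eta> - \<iota> (b - t)) = 0" using ab by simp
    then have "\<eta> = \<iota> t \<or> \<eta> = \<iota> (b - t)" by auto
    then show False using eta by blast
  qed
  have sep: "b * b + 4 * a \<noteq> 0"
  proof
    assume d: "b * b + 4 * a = 0"
    show False
    proof (cases "(2 :: 'k) = 0")
      case False
      define t where "t = b / 2"
      have b: "b = 2 * t" using False by (simp add: t_def)
      have "2 * (2 * (b * t + a - t * t)) = b * b + 4 * a"
        unfolding b by (simp add: algebra_simps)
      then have "b * t + a - t * t = 0" using d False by (metis mult_eq_0_iff)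
      then show False using no_root[of t] by simp
    next
      case True
      then have "(4 :: 'k) = 0" by (metis numeral_Bit0 add.right_neutral)
      then have b: "b = 0" using d by simp
      \<comment> \<open>In characteristic two squaring is an injective, hence surjective, map of the finite field.\<close>
      have "inj (\<lambda>t :: 'k. t * t)"
      proof (rule injI)
        fix s t :: 'k assume st: "s * s = t * t"
        have "s * s + t * t = 2 * (t * t)" unfolding st by (simp only: mult_2)
        moreover have "(s - t) * (s - t) = s * s + t * t - 2 * (s * t)" by (simp add: algebra_simps)
        ultimately have "(s - t) * (s - t) = 0" by (simp only: True) simp
        then show "s = t" by simp
      qed
      then have "surj (\<lambda>t :: 'k. t * t)" using fin finite_UNIV_inj_surj by blast
      then obtain t where "t * t = a" by (metis surjD)
      then show False using no_root[of t] b by simp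
    qed
  qed
  have c0: "coords \<iota> \<eta> 0 = vec 2 (\<lambda>i. if i = 0 then 0 else 0)" using coords[of 0 0] by simp
  have c1: "coords \<iota> \<eta> 1 = vec 2 (\<lambda>i. if i = 0 then 1 else 0)" using coords[of 1 0] by simp
  have ce: "coords \<iota> \<eta> \<eta> = vec 2 (\<lambda>i. if i = 0 then 0 else 1)" using coords[of 0 1] by simp
  have cee: "coords \<iota> \<eta> (\<eta> * \<eta>) = vec 2 (\<lambda>i. if i = 0 then a else b)" using coords[of a b] ab by simp
  have "beta1 \<iota> \<eta> = jordan_companion a b"
    by (rule eq_matI)
      (auto simp: beta1_def embed_M2_def mult_matrix_def jordan_companion_def mat_of_rows_list_def
        mat_of_cols_def c0 c1 ce cee less_Suc_eq eval_nat_numeral)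
  moreover have "irreducible_quadratic a b" by unfold_locales (use no_root sep in auto)
  ultimately show ?thesis by (rule that[rotated])
qed

section \<open>The congruence subgroup of a square-zero thickening of a field\<close>

text \<open>
  The abstract form of the reduction from \<open>o/p^2\<close> to the residue field: \<open>w\<close> is the image of a uniformizer,
  \<open>lift\<close> a set-theoretic section and \<open>\<Psi>\<close> the function induced by the additive character. In these terms
  \<open>K\<close>, \<open>chr\<close> and \<open>stab\<close> below are \<open>K1\<close>, \<open>psi_char\<close> and \<open>char_stabilizer\<close>.
\<close>

locale square_zero_thickening = red: comm_ring_hom red
  for red :: "'r::comm_ring_1 \<Rightarrow> 'k::field" +
  fixes w :: 'r and lift :: "'k \<Rightarrow> 'r" and \<Psi> :: "'r \<Rightarrow> complex" and n :: nat
  assumes red_eq_0_iff: "red x = 0 \<longleftrightarrow> w dvd x"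
    and square_zero: "w * w = 0"
    and red_lift: "red (lift y) = y"
    and nontrivial: "\<exists>y. \<Psi> (w * y) \<noteq> 1"
begin

abbreviation G :: "'r mat monoid" where "G \<equiv> GL TYPE('r) n"

definition K :: "'r mat set" where
  "K = kernel G (GL TYPE('k) n) (map_mat red)"

definition chr :: "'k mat \<Rightarrow> 'r mat \<Rightarrow> complex" where
  "chr \<beta> x = \<Psi> (mat_trace (map_mat lift \<beta> * (x - 1\<^sub>m n)))"

definition stab :: "'k mat \<Rightarrow> 'r mat set" where
  "stab \<beta> = {g \<in> carrier G. \<forall>x\<in>K. chr \<beta> (inv\<^bsub>G\<^esub> g \<otimes>\<^bsub>G\<^esub> x \<otimes>\<^bsub>G\<^esub> g) = chr \<beta> x}"

lemma unit_if_red_nonzero: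
  assumes "red x \<noteq> 0"
  obtains y where "x * y = 1"
proof -
  define z where "z = lift (inverse (red x))"
  have "red (x * z - 1) = 0"
    using assms by (simp add: z_def red.hom_minus red.hom_mult red_lift)
  then obtain u where "x * z - 1 = w * u" unfolding red_eq_0_iff by auto
  then have xz: "x * z = 1 + w * u" by (simp add: algebra_simps)
  have "x * (z * (1 - w * u)) = (1 + w * u) * (1 - w * u)"
    unfolding xz[symmetric] by (simp add: mult.assoc)
  also have "\<dots> = 1 - (w * w) * (u * u)" by (simp add: algebra_simps)
  finally show ?thesis using that square_zero by simp
qed

lemma red_zero_if_character_trivial:
  assumes triv: "\<And>t. \<Psi> (w * t * y) = 1"
  shows "red y = 0"
proof (rule ccontr)
  assume "red y \<noteq> 0"
  then obtain z where yz: "y * z = 1" by (rule unit_if_red_nonzero)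
  have "\<Psi> (w * t) = 1" for t
  proof -
    have "w * (z * t) * y = w * t * (y * z)" by (simp add: ac_simps)
    then show ?thesis using triv[of "z * t"] yz by simp
  qed
  then show False using nontrivial by blast
qed

lemma map_red_hom: "map_mat red \<in> hom G (GL TYPE('k) n)"
proof (rule homI)
  fix x assume x: "x \<in> carrier G"
  note i = GL_inv[OF x]
  have xc: "x \<in> carrier_mat n n" using x by (simp add: GL_carrier_iff)
  show "map_mat red x \<in> carrier (GL TYPE('k) n)"
    unfolding GL_carrier_iff
  proof (intro conjI bexI)
    show "map_mat red (inv\<^bsub>G\<^esub> x) * map_mat red x = 1\<^sub>m n"
      using red.mat_hom_mult[OF i(1) xc] i(2) red.mat_hom_one by metis
    show "map_mat red x * map_mat red (inv\<^bsub>G\<^esub> x) = 1\<^sub>m n"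
      using red.mat_hom_mult[OF xc i(1)] i(3) red.mat_hom_one by metis
  qed (use xc i in auto)
next
  fix x y assume "x \<in> carrier G" "y \<in> carrier G"
  then show "map_mat red (x \<otimes>\<^bsub>G\<^esub> y) = map_mat red x \<otimes>\<^bsub>GL TYPE('k) n\<^esub> map_mat red y"
    using red.mat_hom_mult[of x n n y n] by (simp add: GL_carrier_iff)
qed

lemma K_normal: "K \<lhd> G"
proof -
  interpret group_hom G "GL TYPE('k) n" "map_mat red"
    by (intro group_hom.intro group_hom_axioms.intro group_GL map_red_hom)
  show ?thesis unfolding K_def by (rule normal_kernel)
qed

lemma K_iff: "x \<in> K \<longleftrightarrow> x \<in> carrier G \<and> map_mat red x = 1\<^sub>m n"
  by (simp add: K_def kernel_def)

lemma mult_red_zero: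
  assumes A: "A \<in> carrier_mat m l" and B: "B \<in> carrier_mat l k"
    and A0: "map_mat red A = 0\<^sub>m m l" and B0: "map_mat red B = 0\<^sub>m l k"
  shows "A * B = 0\<^sub>m m k"
proof (rule eq_matI)
  fix i j assume ij: "i < dim_row (0\<^sub>m m k :: 'r mat)" "j < dim_col (0\<^sub>m m k :: 'r mat)"
  have "A $$ (i, p) * B $$ (p, j) = 0" if "p < l" for p
  proof -
    have "red (A $$ (i, p)) = map_mat red A $$ (i, p)" "red (B $$ (p, j)) = map_mat red B $$ (p, j)"
      using A B ij that by auto
    then have "red (A $$ (i, p)) = 0" "red (B $$ (p, j)) = 0"
      using A0 B0 ij that by auto
    then obtain x y where "A $$ (i, p) = w * x" "B $$ (p, j) = w * y"
      unfolding red_eq_0_iff dvd_def by auto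
    then have "A $$ (i, p) * B $$ (p, j) = (w * w) * (x * y)" by (simp add: ac_simps)
    then show ?thesis using square_zero by simp
  qed
  then show "(A * B) $$ (i, j) = 0\<^sub>m m k $$ (i, j)"
    using A B ij by (auto simp: scalar_prod_def intro!: sum.neutral)
qed (use A B in auto)

text \<open>
  For \<open>x\<close> and \<open>y\<close> in \<open>K\<close> the product \<open>(x - 1) (y - 1)\<close> has entries divisible by \<open>w * w\<close>, so it is zero and
  \<open>x y = x + y - 1\<close> is symmetric.
\<close>

lemma K_commute:
  assumes x: "x \<in> K" and y: "y \<in> K"
  shows "x * y = y * x"
proof -
  have c: "x \<in> carrier_mat n n" "y \<in> carrier_mat n n" using x y by (auto simp: K_iff GL_carrier_iff)
  have red1: "map_mat red (z - 1\<^sub>m n) = 0\<^sub>m n n" if "z \<in> K" for z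
  proof -
    have z: "z \<in> carrier_mat n n" "map_mat red z = 1\<^sub>m n" using that by (auto simp: K_iff GL_carrier_iff)
    have "red (z $$ (i, j)) = 1\<^sub>m n $$ (i, j)" if "i < n" "j < n" for i j
      using z that by (metis carrier_matD index_map_mat(1))
    then show ?thesis using z(1) by (intro eq_matI) (auto simp: red.hom_minus)
  qed
  have mult: "a * b = a + b - 1\<^sub>m n"
    if a: "a \<in> carrier_mat n n" and b: "b \<in> carrier_mat n n"
      and 0: "(a - 1\<^sub>m n) * (b - 1\<^sub>m n) = 0\<^sub>m n n" for a b :: "'r mat"
  proof -
    have "(a - 1\<^sub>m n) * (b - 1\<^sub>m n) = a * (b - 1\<^sub>m n) - 1\<^sub>m n * (b - 1\<^sub>m n)"
      using a b by (intro minus_mult_distrib_mat) auto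
    also have "a * (b - 1\<^sub>m n) = a * b - a * 1\<^sub>m n"
      using a b by (intro mult_minus_distrib_mat) auto
    finally have e: "a * b - a - (b - 1\<^sub>m n) = 0\<^sub>m n n" using a b 0 by simp
    have ab: "a * b \<in> carrier_mat n n" using a b by auto
    show ?thesis
    proof (rule eq_matI)
      fix i j assume "i < dim_row (a + b - 1\<^sub>m n)" "j < dim_col (a + b - 1\<^sub>m n)"
      then have ij: "i < n" "j < n" by auto
      have "(a * b - a - (b - 1\<^sub>m n)) $$ (i, j) = 0" unfolding e using ij by simp
      then show "(a * b) $$ (i, j) = (a + b - 1\<^sub>m n) $$ (i, j)"
        using a b ab ij by (simp add: algebra_simps del: index_mult_mat(1))
    qed (use a b in auto)
  qed
  have "x * y = x + y - 1\<^sub>m n"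
    using c mult_red_zero[OF minus_carrier_mat[OF one_carrier_mat] minus_carrier_mat[OF one_carrier_mat] red1[OF x] red1[OF y]] by (intro mult) auto
  also have "\<dots> = y + x - 1\<^sub>m n" using c by (simp add: comm_add_mat[OF c])
  also have "\<dots> = y * x"
    using c mult_red_zero[OF minus_carrier_mat[OF one_carrier_mat] minus_carrier_mat[OF one_carrier_mat] red1[OF y] red1[OF x]] by (intro mult[symmetric]) auto
  finally show ?thesis .
qed

lemma stab_subgroup: "subgroup (stab \<beta>) G"
proof -
  interpret group G by (rule group_GL)
  interpret normal K G by (rule K_normal)
  have KG: "x \<in> carrier G" if "x \<in> K" for x using that by (rule mem_carrier)
  show ?thesis
  proof (rule subgroupI)
    show "stab \<beta> \<subseteq> carrier G" by (auto simp: stab_def)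
    have "\<one>\<^bsub>G\<^esub> \<in> stab \<beta>" unfolding stab_def using KG by (auto simp del: GL_simps)
    then show "stab \<beta> \<noteq> {}" by blast
  next
    fix g assume "g \<in> stab \<beta>"
    then have g: "g \<in> carrier G"
      and s: "\<And>x. x \<in> K \<Longrightarrow> chr \<beta> (inv\<^bsub>G\<^esub> g \<otimes>\<^bsub>G\<^esub> x \<otimes>\<^bsub>G\<^esub> g) = chr \<beta> x" by (auto simp: stab_def)
    have "chr \<beta> (g \<otimes>\<^bsub>G\<^esub> x \<otimes>\<^bsub>G\<^esub> inv\<^bsub>G\<^esub> g) = chr \<beta> x" if x: "x \<in> K" for x
    proof -
      have "inv\<^bsub>G\<^esub> g \<otimes>\<^bsub>G\<^esub> (g \<otimes>\<^bsub>G\<^esub> x \<otimes>\<^bsub>G\<^esub> inv\<^bsub>G\<^esub> g) \<otimes>\<^bsub>G\<^esub> g = x"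
        using g KG[OF x] by (simp add: m_assoc inv_solve_left' del: GL_simps)
      then show ?thesis using s[OF inv_op_closed2[OF g x]] by (simp del: GL_simps)
    qed
    then show "inv\<^bsub>G\<^esub> g \<in> stab \<beta>" unfolding stab_def using g by (simp del: GL_simps)
  next
    fix g h assume "g \<in> stab \<beta>" "h \<in> stab \<beta>"
    then have g: "g \<in> carrier G" and h: "h \<in> carrier G"
      and sg: "\<And>x. x \<in> K \<Longrightarrow> chr \<beta> (inv\<^bsub>G\<^esub> g \<otimes>\<^bsub>G\<^esub> x \<otimes>\<^bsub>G\<^esub> g) = chr \<beta> x"
      and sh: "\<And>x. x \<in> K \<Longrightarrow> chr \<beta> (inv\<^bsub>G\<^esub> h \<otimes>\<^bsub>G\<^esub> x \<otimes>\<^bsub>G\<^esub> h) = chr \<beta> x" by (auto simp: stab_def)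
    have "chr \<beta> (inv\<^bsub>G\<^esub> (g \<otimes>\<^bsub>G\<^esub> h) \<otimes>\<^bsub>G\<^esub> x \<otimes>\<^bsub>G\<^esub> (g \<otimes>\<^bsub>G\<^esub> h)) = chr \<beta> x" if x: "x \<in> K" for x
    proof -
      have "inv\<^bsub>G\<^esub> (g \<otimes>\<^bsub>G\<^esub> h) \<otimes>\<^bsub>G\<^esub> x \<otimes>\<^bsub>G\<^esub> (g \<otimes>\<^bsub>G\<^esub> h) =
          inv\<^bsub>G\<^esub> h \<otimes>\<^bsub>G\<^esub> (inv\<^bsub>G\<^esub> g \<otimes>\<^bsub>G\<^esub> x \<otimes>\<^bsub>G\<^esub> g) \<otimes>\<^bsub>G\<^esub> h"
        using g h KG[OF x] by (simp add: m_assoc inv_mult_group del: GL_simps)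
      then show ?thesis using sg[OF x] sh[OF inv_op_closed1[OF g x]] by (simp del: GL_simps)
    qed
    then show "g \<otimes>\<^bsub>G\<^esub> h \<in> stab \<beta>" unfolding stab_def using g h by (simp del: GL_simps)
  qed
qed

lemma K_subset_stab: "K \<subseteq> stab \<beta>"
proof
  fix g assume g: "g \<in> K"
  interpret group G by (rule group_GL)
  have gG: "g \<in> carrier G" using g by (simp add: K_iff)
  have "inv\<^bsub>G\<^esub> g \<otimes>\<^bsub>G\<^esub> x \<otimes>\<^bsub>G\<^esub> g = x" if x: "x \<in> K" for x
  proof -
    have xG: "x \<in> carrier G" using x by (simp add: K_iff)
    have "x \<otimes>\<^bsub>G\<^esub> g = g \<otimes>\<^bsub>G\<^esub> x" using K_commute[OF x g] by simp
    then have "inv\<^bsub>G\<^esub> g \<otimes>\<^bsub>G\<^esub> x \<otimes>\<^bsub>G\<^esub> g = inv\<^bsub>G\<^esub> g \<otimes>\<^bsub>G\<^esub> (g \<otimes>\<^bsub>G\<^esub> x)"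
      using gG xG by (simp add: m_assoc del: GL_simps)
    then show ?thesis using gG xG by (simp add: m_assoc[symmetric] del: GL_simps)
  qed
  then show "g \<in> stab \<beta>" unfolding stab_def using gG by (simp del: GL_simps)
qed

text \<open>
  Cyclicity of the trace moves conjugation from the argument \<open>x\<close> to \<open>\<beta>\<close>.
\<close>

lemma chr_conjugate:
  assumes \<beta>: "\<beta> \<in> carrier_mat n n" and g: "g \<in> carrier_mat n n" and h: "h \<in> carrier_mat n n"
    and gh: "g * h = 1\<^sub>m n" and x: "x \<in> carrier_mat n n"
  shows "chr \<beta> (g * x * h) = \<Psi> (mat_trace ((h * map_mat lift \<beta> * g) * (x - 1\<^sub>m n)))"
proof -
  let ?B = "map_mat lift \<beta>"
  have B: "?B \<in> carrier_mat n n" using \<beta> by auto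
  have X: "x - 1\<^sub>m n \<in> carrier_mat n n" using x by auto
  have "g * (x - 1\<^sub>m n) * h = (g * x - g * 1\<^sub>m n) * h"
    using g x by (subst mult_minus_distrib_mat[of _ n n]) auto
  also have "\<dots> = g * x * h - g * h"
    using g h x by (subst minus_mult_distrib_mat[of _ n n]) auto
  finally have e: "g * x * h - 1\<^sub>m n = g * (x - 1\<^sub>m n) * h" using gh by simp
  have "mat_trace (?B * (g * (x - 1\<^sub>m n) * h)) = mat_trace ((?B * g * (x - 1\<^sub>m n)) * h)"
    using B g h X by (simp add: assoc_mult_mat[of _ n n _ n _ n])
  also have "\<dots> = mat_trace (h * (?B * g * (x - 1\<^sub>m n)))"
    using B g h X by (intro mat_trace_commute[of _ n n]) auto
  also have "h * (?B * g * (x - 1\<^sub>m n)) = (h * ?B * g) * (x - 1\<^sub>m n)"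
    using B g h X by (simp add: assoc_mult_mat[of _ n n _ n _ n])
  finally show ?thesis unfolding chr_def e by simp
qed

lemma elementary_in_K:
  assumes "i \<noteq> j" "i < n" "j < n" "w dvd c"
  shows "addrow_mat n c i j \<in> K"
  unfolding K_iff using elementary_in_GL[OF assms(1-3), of c] assms(4)
  by (auto simp: red.hom_add red_eq_0_iff)

text \<open>
  The local step of Mackey's criterion. Let \<open>u\<close> be elementary with entry \<open>w t\<close> at \<open>(i, j)\<close> and let
  \<open>x = g u g\<^sup>-\<^sup>1\<close>, an element of \<open>K\<close>. Then \<open>x g = g u\<close>, so \<open>f (x g)\<close> is both \<open>chr \<beta> x\<close> times \<open>f g\<close> and \<open>f g\<close>.
  Hence \<open>chr \<beta> x = 1\<close>, and this value is \<open>\<Psi>\<close> of \<open>w t\<close> times the \<open>(j, i)\<close> entry of \<open>g\<^sup>-\<^sup>1 \<beta> g\<close>.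
\<close>

lemma conjugate_entry_zero:
  assumes \<beta>: "\<beta> \<in> carrier_mat n n"
    and \<rho>: "\<And>x. x \<in> K \<Longrightarrow> \<rho> x = chr \<beta> x \<cdot>\<^sub>m 1\<^sub>m 1"
    and f: "f \<in> ind_space G (stab \<beta>) 1 \<rho>" and g: "g \<in> carrier G" and fg: "f g \<noteq> 0\<^sub>v 1"
    and ij: "i \<noteq> j" "i < n" "j < n"
    and inv: "\<And>c. w dvd c \<Longrightarrow> f (g * addrow_mat n c i j) = f g"
  shows "map_mat red (inv\<^bsub>G\<^esub> g * map_mat lift \<beta> * g) $$ (j, i) = 0"
proof -
  interpret normal K G by (rule K_normal)
  let ?h = "inv\<^bsub>G\<^esub> g"
  let ?Y = "?h * map_mat lift \<beta> * g"
  note h = GL_inv[OF g]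
  have gc: "g \<in> carrier_mat n n" using g by (simp add: GL_carrier_iff)
  have Y: "?Y \<in> carrier_mat n n" using h gc \<beta> by auto
  have fgc: "f g \<in> carrier_vec 1" using f g by (auto simp: ind_space_def)
  have "\<Psi> (w * t * ?Y $$ (j, i)) = 1" for t
  proof -
    let ?u = "addrow_mat n (w * t) i j"
    have uK: "?u \<in> K" by (rule elementary_in_K[OF ij]) simp
    have uc: "?u \<in> carrier_mat n n" by simp
    let ?x = "g * ?u * ?h"
    have xK: "?x \<in> K" using inv_op_closed2[OF g uK] by simp
    have "?x * g = g * ?u * (?h * g)"
      using gc uc h(1) by (intro assoc_mult_mat) auto
    then have "?x * g = g * ?u" using h(2) gc uc by simp
    moreover have "f (?x * g) = \<rho> ?x *\<^sub>v f g"
      using f g K_subset_stab[of \<beta>] xK by (auto simp: ind_space_def)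
    ultimately have "\<rho> ?x *\<^sub>v f g = f g" using inv[of "w * t"] by simp
    then have e: "(chr \<beta> ?x \<cdot>\<^sub>m 1\<^sub>m 1) *\<^sub>v f g = f g" using \<rho>[OF xK] by simp
    have "f g $ 0 \<noteq> 0" using fg fgc by (metis carrier_vecD eq_vecI index_zero_vec less_one)
    moreover have "chr \<beta> ?x * f g $ 0 = f g $ 0"
    proof -
      have "((chr \<beta> ?x \<cdot>\<^sub>m 1\<^sub>m 1) *\<^sub>v f g) $ 0 = chr \<beta> ?x * f g $ 0"
        using fgc by (simp add: scalar_prod_def)
      moreover have "((chr \<beta> ?x \<cdot>\<^sub>m 1\<^sub>m 1) *\<^sub>v f g) $ 0 = f g $ 0" by (rule arg_cong[OF e])
      ultimately show ?thesis by (rule trans[OF sym])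
    qed
    ultimately have "chr \<beta> ?x = 1" by simp
    then have "\<Psi> (mat_trace (?Y * (?u - 1\<^sub>m n))) = 1"
      using chr_conjugate[OF \<beta> gc h(1) h(3) uc] by simp
    then show ?thesis using mat_trace_mult_elementary[OF Y ij] by simp
  qed
  then have "red (?Y $$ (j, i)) = 0" by (rule red_zero_if_character_trivial)
  then show ?thesis using Y ij by (subst index_map_mat(1)) auto
qed

lemma red_conjugate:
  assumes \<beta>: "\<beta> \<in> carrier_mat n n" and g: "g \<in> carrier G"
  defines "Y \<equiv> map_mat red (inv\<^bsub>G\<^esub> g * map_mat lift \<beta> * g)"
  shows "Y \<in> carrier_mat n n" "\<beta> * map_mat red g = map_mat red g * Y"
    "map_mat red (inv\<^bsub>G\<^esub> g) * \<beta> = Y * map_mat red (inv\<^bsub>G\<^esub> g)"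
    "map_mat red (inv\<^bsub>G\<^esub> g) * map_mat red g = 1\<^sub>m n"
    "map_mat red g * map_mat red (inv\<^bsub>G\<^esub> g) = 1\<^sub>m n"
proof -
  note h = GL_inv[OF g]
  have gc: "g \<in> carrier_mat n n" using g by (simp add: GL_carrier_iff)
  let ?g = "map_mat red g" and ?h = "map_mat red (inv\<^bsub>G\<^esub> g)"
  have c: "?g \<in> carrier_mat n n" "?h \<in> carrier_mat n n" using gc h by auto
  show hg: "?h * ?g = 1\<^sub>m n" using red.mat_hom_mult[OF h(1) gc] h(2) red.mat_hom_one by metis
  show gh: "?g * ?h = 1\<^sub>m n" using red.mat_hom_mult[OF gc h(1)] h(3) red.mat_hom_one by metis
  have B: "map_mat lift \<beta> \<in> carrier_mat n n" using \<beta> by simp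
  have "map_mat red (map_mat lift \<beta>) = \<beta>" by (rule eq_matI) (auto simp: red_lift)
  then have "map_mat red (inv\<^bsub>G\<^esub> g * map_mat lift \<beta>) = ?h * \<beta>"
    using red.mat_hom_mult[OF h(1) B] by simp
  then have Y: "Y = ?h * \<beta> * ?g"
    unfolding Y_def using red.mat_hom_mult[OF mult_carrier_mat[OF h(1) B] gc] by simp
  show "Y \<in> carrier_mat n n" unfolding Y using c \<beta> by auto
  have "?g * Y = (?g * ?h) * (\<beta> * ?g)"
    unfolding Y using c \<beta> by (simp add: assoc_mult_mat[of _ n n _ n _ n])
  then show "\<beta> * ?g = ?g * Y" unfolding gh using c \<beta> by simp
  have "Y * ?h = (?h * \<beta>) * (?g * ?h)"
    unfolding Y using c \<beta> by (simp add: assoc_mult_mat[of _ n n _ n _ n])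
  then show "?h * \<beta> = Y * ?h" unfolding gh using c \<beta> by simp
qed

end

context square_zero_thickening
begin

text \<open>
  Block elimination. The upper left block \<open>P\<close> is invertible because its determinant is a unit modulo \<open>w\<close>.
  Clearing the lower left block \<open>R\<close> takes the lower unipotent matrix with block \<open>- R P\<^sup>-\<^sup>1\<close>, which lies
  in \<open>K\<close> as \<open>R\<close> reduces to zero.
\<close>

lemma K_times_block_triangular:
  assumes n: "n = p + q" and g: "g \<in> carrier G"
    and low: "\<And>i j. p \<le> i \<Longrightarrow> i < p + q \<Longrightarrow> j < p \<Longrightarrow> red (g $$ (i, j)) = 0"
  obtains k P L Q S where "k \<in> K" "k * g = four_block_mat P Q (0\<^sub>m q p) S" "P * L = 1\<^sub>m p"
    "P \<in> carrier_mat p p" "L \<in> carrier_mat p p" "Q \<in> carrier_mat p q" "S \<in> carrier_mat q q"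
proof -
  have gc: "g \<in> carrier_mat (p + q) (p + q)" using g n by (simp add: GL_carrier_iff)
  obtain P Q R S where sb: "split_block g p p = (P, Q, R, S)" by (cases "split_block g p p") auto
  have dims: "dim_row g = p + q" "dim_col g = p + q" using gc by auto
  note s = split_block[OF sb dims]
  have R0: "map_mat red R = 0\<^sub>m q p"
  proof (rule eq_matI)
    fix i j assume "i < dim_row (0\<^sub>m q p :: 'k mat)" "j < dim_col (0\<^sub>m q p :: 'k mat)"
    then have ij: "i < q" "j < p" by auto
    have "g $$ (i + p, j) = R $$ (i, j)" using s ij by (simp add: s(5))
    then show "map_mat red R $$ (i, j) = 0\<^sub>m q p $$ (i, j)"
      using low[of "i + p" j] s(3) ij by simp
  qed (use s(3) in auto)
  have "red (det g) \<noteq> 0"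
  proof -
    have "map_mat red g \<in> carrier (GL TYPE('k) n)" using map_red_hom g by (auto simp: hom_def)
    then obtain h where "h \<in> carrier_mat n n" "h * map_mat red g = 1\<^sub>m n"
      by (auto simp: GL_carrier_iff)
    then have "det h * det (map_mat red g) = 1"
      using det_mult[of h n "map_mat red g"] gc n by (metis det_one map_carrier_mat)
    then show ?thesis by auto
  qed
  moreover have "map_mat red g = four_block_mat (map_mat red P) (map_mat red Q) (0\<^sub>m q p) (map_mat red S)"
    using map_four_block_mat[OF s(1-4), of red] s(5) R0 by simp
  then have "red (det g) = red (det P) * red (det S)"
    using det_four_block_mat_lower_left_zero[of "map_mat red P" p "map_mat red Q" q "0\<^sub>m q p" "map_mat red S"] s(1-4)
    by (metis map_carrier_mat red.hom_det)
  ultimately have "red (det P) \<noteq> 0" by auto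
  then obtain d where d: "det P * d = 1" by (rule unit_if_red_nonzero)
  define L where "L = d \<cdot>\<^sub>m adj_mat P"
  note adj = adj_mat[OF s(1)]
  have Lc: "L \<in> carrier_mat p p" using adj(1) by (simp add: L_def)
  have dd: "d \<cdot>\<^sub>m (det P \<cdot>\<^sub>m 1\<^sub>m p) = 1\<^sub>m p"
    using d by (intro eq_matI) (auto simp: mult.commute)
  have PL: "P * L = 1\<^sub>m p"
    unfolding L_def using adj s(1) dd by (simp add: mult_smult_distrib[of _ p p _ p])
  have LP: "L * P = 1\<^sub>m p"
    unfolding L_def using adj s(1) dd by (simp add: mult_smult_assoc_mat[of _ p p _ p])
  define N where "N = - (R * L)"
  have Nc: "N \<in> carrier_mat q p" using s Lc by (auto simp: N_def)
  have RL0: "map_mat red (R * L) = 0\<^sub>m q p"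
    using red.mat_hom_mult[OF s(3) Lc] R0 Lc by simp
  have N0: "map_mat red N = 0\<^sub>m q p"
  proof (rule eq_matI)
    fix i j assume "i < dim_row (0\<^sub>m q p :: 'k mat)" "j < dim_col (0\<^sub>m q p :: 'k mat)"
    then have ij: "i < q" "j < p" by auto
    have "map_mat red (R * L) $$ (i, j) = 0" unfolding RL0 using ij by simp
    moreover have "R * L \<in> carrier_mat q p" using s(3) Lc by simp
    ultimately show "map_mat red N $$ (i, j) = 0\<^sub>m q p $$ (i, j)"
      unfolding N_def using ij s(3) Lc by (simp add: red.hom_uminus del: index_mult_mat(1))
  qed (use Nc in auto)
  let ?k = "\<lambda>N. four_block_mat (1\<^sub>m p) (0\<^sub>m p q) N (1\<^sub>m q)"
  have kk: "?k A * ?k B = ?k (A + B)" if "A \<in> carrier_mat q p" "B \<in> carrier_mat q p" for A B :: "'r mat"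
    using that by (subst mult_four_block_mat[of _ p p _ q _ q _ _ p _ q]) auto
  have mN: "- N \<in> carrier_mat q p" using Nc by simp
  have "?k (- N) * ?k N = 1\<^sub>m n" "?k N * ?k (- N) = 1\<^sub>m n"
    using kk[OF mN Nc] kk[OF Nc mN] Nc n
    by (simp_all add: one_four_block uminus_l_inv_mat[of _ q p] comm_add_mat[of N q p "- N"])
  then have "?k N \<in> carrier G"
    unfolding GL_carrier_iff using Nc n by (intro conjI bexI[of _ "?k (- N)"]) auto
  moreover have "map_mat red (?k N) = 1\<^sub>m n"
  proof -
    have "map_mat red (?k N) = four_block_mat (map_mat red (1\<^sub>m p)) (map_mat red (0\<^sub>m p q)) (map_mat red N) (map_mat red (1\<^sub>m q))"
      using Nc by (intro map_four_block_mat[of _ p p _ q _ q]) auto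
    moreover have "map_mat red (0\<^sub>m p q) = 0\<^sub>m p q" by (rule eq_matI) auto
    ultimately show ?thesis using N0 red.mat_hom_one one_four_block n by metis
  qed
  ultimately have "?k N \<in> K" by (simp add: K_iff)
  moreover have "?k N * g = four_block_mat P Q (0\<^sub>m q p) (N * Q + S)"
  proof -
    have "N * P = - (R * L * P)" unfolding N_def using s Lc by simp
    also have "R * L * P = R" using s Lc LP by (simp add: assoc_mult_mat[of _ q p _ p _ p])
    finally have "N * P + R = 0\<^sub>m q p" using s(3) by (simp add: uminus_l_inv_mat)
    then show ?thesis
      unfolding s(5) using s(1-4) Nc by (subst mult_four_block_mat[of _ p p _ q _ q _ _ p _ q]) auto
  qed
  moreover have "N * Q + S \<in> carrier_mat q q" using Nc s by auto
  ultimately show ?thesis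
    using PL s(1,2) Lc that[where k = "?k N" and P = P and L = L and Q = Q and S = "N * Q + S"]
    by blast
qed

end

section \<open>Fixed vectors and invariant subspaces of beta\<close>

locale thickening_with_beta = square_zero_thickening red w lift \<Psi> 4 + irreducible_quadratic a b
  for red :: "'r::comm_ring_1 \<Rightarrow> 'k::field" and w lift \<Psi> a b +
  fixes \<beta> :: "'k mat" and \<rho> :: "'r mat \<Rightarrow> complex mat"
  assumes \<beta>: "\<beta> = jordan_companion a b"
    and \<rho>: "x \<in> K \<Longrightarrow> \<rho> x = chr \<beta> x \<cdot>\<^sub>m 1\<^sub>m 1"
begin

lemma \<beta>_carrier: "\<beta> \<in> carrier_mat 4 4" by (simp add: \<beta>)

text \<open>
  The first column of \<open>g\<close> would reduce to an eigenvector of \<open>\<beta>\<close>.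
\<close>

lemma no_line_fixed:
  assumes f: "f \<in> ind_space G (stab \<beta>) 1 \<rho>" and g: "g \<in> carrier G" and fg: "f g \<noteq> 0\<^sub>v 1"
    and inv: "\<And>c j. w dvd c \<Longrightarrow> j \<in> {1, 2, 3} \<Longrightarrow> f (g * addrow_mat 4 c 0 j) = f g"
  shows False
proof -
  let ?Y = "map_mat red (inv\<^bsub>G\<^esub> g * map_mat lift \<beta> * g)"
  let ?g = "map_mat red g" and ?h = "map_mat red (inv\<^bsub>G\<^esub> g)"
  note r = red_conjugate[OF \<beta>_carrier g]
  have gc: "?g \<in> carrier_mat 4 4" "?h \<in> carrier_mat 4 4"
    using g GL_inv[OF g] by (auto simp: GL_carrier_iff)
  have Y0: "?Y $$ (j, 0) = 0" if "j \<in> {1, 2, 3}" for j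
    by (rule conjugate_entry_zero[OF \<beta>_carrier \<rho> f g fg]) (use inv that in auto)
  have "(jordan_companion a b * ?g) $$ (i, 0) = ?Y $$ (0, 0) * ?g $$ (i, 0)" if "i < 4" for i
    using mult_mat_4_entry[OF gc(1) r(1) that, of 0] Y0[of 1] Y0[of 2] Y0[of 3] r(2)
    unfolding \<beta> by simp
  then have z: "?g $$ (i, 0) = 0" if "i < 4" for i
    using eigen_column_zero[OF gc(1), of 0 "?Y $$ (0, 0)" i] that by simp
  have "(?h * ?g) $$ (0, 0) = 0"
    using mult_mat_4_entry[OF gc(2,1), of 0 0] z[of 0] z[of 1] z[of 2] z[of 3] by simp
  then show False unfolding r(4) by simp
qed

text \<open>
  The last row of the inverse of \<open>g\<close> would reduce to a left eigenvector of \<open>\<beta>\<close>.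
\<close>

lemma no_hyperplane_fixed:
  assumes f: "f \<in> ind_space G (stab \<beta>) 1 \<rho>" and g: "g \<in> carrier G" and fg: "f g \<noteq> 0\<^sub>v 1"
    and inv: "\<And>c i. w dvd c \<Longrightarrow> i \<in> {0, 1, 2} \<Longrightarrow> f (g * addrow_mat 4 c i 3) = f g"
  shows False
proof -
  let ?Y = "map_mat red (inv\<^bsub>G\<^esub> g * map_mat lift \<beta> * g)"
  let ?g = "map_mat red g" and ?h = "map_mat red (inv\<^bsub>G\<^esub> g)"
  note r = red_conjugate[OF \<beta>_carrier g]
  have gc: "?g \<in> carrier_mat 4 4" "?h \<in> carrier_mat 4 4"
    using g GL_inv[OF g] by (auto simp: GL_carrier_iff)
  have Y0: "?Y $$ (3, i) = 0" if "i \<in> {0, 1, 2}" for i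
    by (rule conjugate_entry_zero[OF \<beta>_carrier \<rho> f g fg]) (use inv that in auto)
  have "(?h * jordan_companion a b) $$ (3, j) = ?Y $$ (3, 3) * ?h $$ (3, j)" if "j < 4" for j
    using mult_mat_4_entry[OF r(1) gc(2) _ that, of 3] Y0[of 0] Y0[of 1] Y0[of 2] r(3)
    unfolding \<beta> by simp
  then have z: "?h $$ (3, j) = 0" if "j < 4" for j
    using eigen_row_zero[OF gc(2), of 3 "?Y $$ (3, 3)" j] that by simp
  have "(?h * ?g) $$ (3, 3) = 0"
    using mult_mat_4_entry[OF gc(2,1), of 3 3] z[of 0] z[of 1] z[of 2] z[of 3] by simp
  then show False unfolding r(4) by simp
qed

text \<open>
  With \<open>k g\<close> block triangular and \<open>k\<close> in \<open>K\<close>, the function still does not vanish at \<open>k g\<close>, since \<open>K\<close> acts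
  through a character. An element \<open>u\<close> of the intersection satisfies \<open>u (k g) = (k g) u'\<close> with \<open>u'\<close> in the
  unipotent group, so \<open>f (k g)\<close> is fixed by \<open>\<rho> u\<close>.
\<close>

lemma plane_fixed_imp_trivial:
  assumes f: "f \<in> ind_space G (stab \<beta>) 1 \<rho>" and g: "g \<in> carrier G" and fg: "f g \<noteq> 0\<^sub>v 1"
    and inv: "\<And>x u. x \<in> carrier G \<Longrightarrow> u \<in> U_geom 2 2 \<Longrightarrow> f (x * u) = f x"
  shows "contains_trivial (stab \<beta> \<inter> U_geom 2 2) 1 \<rho>"
proof -
  let ?Y = "map_mat red (inv\<^bsub>G\<^esub> g * map_mat lift \<beta> * g)"
  let ?g = "map_mat red g"
  note r = red_conjugate[OF \<beta>_carrier g]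
  have gc: "?g \<in> carrier_mat 4 4" "g \<in> carrier_mat 4 4"
    using g by (auto simp: GL_carrier_iff)
  have Y0: "?Y $$ (j, i) = 0" if "j \<in> {2, 3}" "i \<in> {0, 1}" for i j
  proof (rule conjugate_entry_zero[OF \<beta>_carrier \<rho> f g fg])
    show "f (g * addrow_mat 4 c i j) = f g" for c
      using inv[OF g, of "addrow_mat 4 c i j"] elementary_in_U_geom[of i 2 j 2 c] that by auto
  qed (use that in auto)
  have g0: "?g $$ (i, j) = 0" if "i \<in> {2, 3}" "j \<in> {0, 1}" for i j
    by (rule invariant_plane[OF gc(1) r(1) _ _ that]) (use Y0 r(2) in \<open>auto simp flip: \<beta>\<close>)
  obtain k P L Q S where k: "k \<in> K" and kg: "k * g = four_block_mat P Q (0\<^sub>m 2 2) S"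
    and PL: "P * L = 1\<^sub>m 2" and c: "P \<in> carrier_mat 2 2" "L \<in> carrier_mat 2 2"
      "Q \<in> carrier_mat 2 2" "S \<in> carrier_mat 2 2"
  proof (rule K_times_block_triangular[OF _ g, of 2 2])
    fix i j :: nat assume "2 \<le> i" "i < 2 + 2" "j < 2"
    then have ij: "i \<in> {2, 3}" "j \<in> {0, 1}" by auto
    then show "red (g $$ (i, j)) = 0" using g0[OF ij] gc by auto
  qed auto
  interpret G: group G by (rule group_GL)
  have kG: "k \<in> carrier G" using k by (simp add: K_iff)
  have kgG: "k * g \<in> carrier G" using G.m_closed[OF kG g] by simp
  have kS: "k \<in> stab \<beta>" using k K_subset_stab by auto
  have fkg: "f (k * g) \<in> carrier_vec 1" "f (k * g) \<noteq> 0\<^sub>v 1"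
  proof -
    show "f (k * g) \<in> carrier_vec 1" using f kgG by (auto simp: ind_space_def)
    show "f (k * g) \<noteq> 0\<^sub>v 1"
    proof
      assume z: "f (k * g) = 0\<^sub>v 1"
      have ik: "inv\<^bsub>G\<^esub> k \<in> K"
        using normal_imp_subgroup[OF K_normal] k by (simp add: subgroup.m_inv_closed)
      have "inv\<^bsub>G\<^esub> k * (k * g) = g"
        using G.m_assoc[of "inv\<^bsub>G\<^esub> k" k g] kG g G.l_one[OF g] G.l_inv[OF kG] by simp
      moreover have "f (inv\<^bsub>G\<^esub> k * (k * g)) = \<rho> (inv\<^bsub>G\<^esub> k) *\<^sub>v f (k * g)"
        using f kgG ik K_subset_stab[of \<beta>] by (auto simp: ind_space_def)
      ultimately have "f g = 0\<^sub>v 1" using \<rho>[OF ik] unfolding z by (simp add: vec_eq_iff)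
      then show False using fg by simp
    qed
  qed
  have "\<rho> u *\<^sub>v f (k * g) = f (k * g)" if u: "u \<in> stab \<beta> \<inter> U_geom 2 2" for u
  proof -
    obtain u' where u': "u' \<in> U_geom 2 2" "u * (k * g) = k * g * u'"
      unfolding kg using U_geom_conjugate[OF _ c(1,2) PL c(3,4), of u] u by auto
    have "f (u * (k * g)) = \<rho> u *\<^sub>v f (k * g)" using f kgG u by (auto simp: ind_space_def)
    then show ?thesis using inv[OF kgG u'(1)] u'(2) by simp
  qed
  then show ?thesis unfolding contains_char_def using fkg by auto
qed

end

section \<open>Quotients of the ring of integers\<close>

lemma quotient_map_diff:
  assumes "quotient_map R I f" "x \<in> R" "y \<in> R" "x - y \<in> R"
  shows "f (x - y) = f x - f y"
proof -
  have "f (x - y + y) = f (x - y) + f y" using assms unfolding quotient_map_def by blast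
  then show ?thesis by (simp add: algebra_simps)
qed

lemma quotient_map_inv_into:
  assumes "quotient_map R I f"
  shows "inv_into R f y \<in> R" "f (inv_into R f y) = y"
  using assms inv_into_into[of y f R] f_inv_into_f[of y f R] by (auto simp: quotient_map_def)

locale local_field =
  fixes v :: "'a::field \<Rightarrow> int"
  assumes local_field: "nonarch_local_field v"
begin

lemma val_mult: "x \<noteq> 0 \<Longrightarrow> y \<noteq> 0 \<Longrightarrow> v (x * y) = v x + v y"
  using local_field by (auto simp: nonarch_local_field_def)

lemma val_one: "v 1 = 0"
  using val_mult[of 1 1] by simp

lemma val_minus: "v (- x) = v x"
proof (cases "x = 0")
  case False
  have "v (- 1) = 0" using val_mult[of "- 1" "- 1"] val_one by simp
  then show ?thesis using val_mult[of "- 1" x] False by simp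
qed simp

lemma pideal_add: "x \<in> pideal v k \<Longrightarrow> y \<in> pideal v k \<Longrightarrow> x + y \<in> pideal v k"
proof -
  assume xy: "x \<in> pideal v k" "y \<in> pideal v k"
  have "v (x + y) \<ge> min (v x) (v y)" if "x \<noteq> 0" "y \<noteq> 0" "x + y \<noteq> 0"
    using local_field that by (auto simp: nonarch_local_field_def)
  then show ?thesis using xy by (fastforce simp: pideal_def)
qed

lemma pideal_diff: "x \<in> pideal v k \<Longrightarrow> y \<in> pideal v k \<Longrightarrow> x - y \<in> pideal v k"
  using pideal_add[of x k "- y"] by (simp add: pideal_def val_minus)

lemma pideal_mult: "x \<in> pideal v k \<Longrightarrow> y \<in> pideal v l \<Longrightarrow> x * y \<in> pideal v (k + l)"
  by (cases "x = 0 \<or> y = 0") (auto simp: pideal_def val_mult)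

lemma pideal_mono: "k \<le> l \<Longrightarrow> pideal v l \<subseteq> pideal v k"
  by (auto simp: pideal_def)

lemma one_integer: "1 \<in> integers v"
  by (simp add: pideal_def val_one)

lemma finite_residue_field:
  fixes r1 :: "'a \<Rightarrow> 'k::field"
  assumes r1: "quotient_map (integers v) (pideal v 1) r1"
  shows "finite (UNIV :: 'k set)"
proof -
  define E where "E = {(x, y). x \<in> integers v \<and> y \<in> integers v \<and> x - y \<in> pideal v 1}"
  define lft where "lft = inv_into (integers v) r1"
  note l = quotient_map_inv_into[OF r1, folded lft_def]
  have fin: "finite (integers v // E)"
    using local_field by (auto simp: nonarch_local_field_def E_def)
  have "inj (\<lambda>b. E `` {lft b})"
  proof (rule injI)
    fix b c assume "E `` {lft b} = E `` {lft c}"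
    moreover have "lft b \<in> E `` {lft b}" using l(1) by (auto simp: E_def pideal_def)
    ultimately have "lft c - lft b \<in> pideal v 1" by (auto simp: E_def)
    then have "r1 (lft c - lft b) = 0"
      using r1 l(1) pideal_diff[OF l(1) l(1)] by (auto simp: quotient_map_def)
    then show "b = c" using quotient_map_diff[OF r1 l(1) l(1) pideal_diff[OF l(1) l(1)]] l(2) by simp
  qed
  moreover have "range (\<lambda>b. E `` {lft b}) \<subseteq> integers v // E"
    using l(1) by (auto simp: quotient_def)
  ultimately show ?thesis using fin by (meson finite_imageD finite_subset)
qed

end

locale length_two_quotient = local_field v
  for v :: "'a::field \<Rightarrow> int" +
  fixes r2 :: "'a \<Rightarrow> 'r::comm_ring_1" and r1 :: "'a \<Rightarrow> 'k::field"
  assumes r2: "quotient_map (integers v) (pideal v 2) r2"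
    and r1: "quotient_map (integers v) (pideal v 1) r1"
begin

abbreviation red :: "'r \<Rightarrow> 'k" where "red \<equiv> reduction v r2 r1"

lemma r2_hom:
  assumes "x \<in> integers v" "y \<in> integers v"
  shows "r2 (x + y) = r2 x + r2 y" "r2 (x * y) = r2 x * r2 y"
  using r2 assms by (auto simp: quotient_map_def)

lemma r1_hom:
  assumes "x \<in> integers v" "y \<in> integers v"
  shows "r1 (x + y) = r1 x + r1 y" "r1 (x * y) = r1 x * r1 y"
  using r1 assms by (auto simp: quotient_map_def)

lemma kernels:
  assumes "x \<in> integers v"
  shows "r2 x = 0 \<longleftrightarrow> x \<in> pideal v 2" "r1 x = 0 \<longleftrightarrow> x \<in> pideal v 1"
  using r1 r2 assms by (auto simp: quotient_map_def)

lemma lift_diff: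
  assumes "x \<in> integers v"
  shows "inv_into (integers v) r2 (r2 x) - x \<in> pideal v 2"
proof -
  note l = quotient_map_inv_into[OF r2]
  have d: "inv_into (integers v) r2 (r2 x) - x \<in> integers v"
    using pideal_diff[OF l(1) assms] by simp
  then show ?thesis
    using kernels(1)[OF d] quotient_map_diff[OF r2 l(1) assms d] l(2)[of "r2 x"] by simp
qed

lemma red_r2:
  assumes x: "x \<in> integers v"
  shows "red (r2 x) = r1 x"
proof -
  let ?y = "inv_into (integers v) r2 (r2 x)"
  note l = quotient_map_inv_into[OF r2]
  have d: "?y - x \<in> integers v" using pideal_diff[OF l(1) x] by simp
  have "?y - x \<in> pideal v 1" using lift_diff[OF x] pideal_mono[of 1 2] by auto
  then have "r1 ?y - r1 x = 0" using kernels(2)[OF d] quotient_map_diff[OF r1 l(1) x d] by simp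
  then show ?thesis by (simp add: reduction_def)
qed

lemma red_hom: "comm_ring_hom red"
proof -
  note l = quotient_map_inv_into[OF r2]
  let ?i = "inv_into (integers v) r2"
  have add: "red (x + y) = red x + red y" and mult: "red (x * y) = red x * red y" for x y
  proof -
    have i: "?i x \<in> integers v" "?i y \<in> integers v" by (rule l)+
    have "x + y = r2 (?i x + ?i y)" "x * y = r2 (?i x * ?i y)" using r2_hom[OF i] l(2) by auto
    moreover have "?i x + ?i y \<in> integers v" "?i x * ?i y \<in> integers v"
      using pideal_add[OF i] pideal_mult[OF i] by auto
    ultimately show "red (x + y) = red x + red y" "red (x * y) = red x * red y"
      using r1_hom[OF i] red_r2 by (auto simp: reduction_def)
  qed
  have one: "red 1 = 1"
    using red_r2[OF one_integer] r1 r2 by (simp add: quotient_map_def)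
  have zero: "red 0 = 0" by (metis add add.right_neutral add_left_imp_eq)
  show ?thesis by unfold_locales (use add mult one zero in auto)
qed

lemma uniformizer:
  "\<exists>w. w * w = 0 \<and> (\<forall>x. red x = 0 \<longleftrightarrow> w dvd x) \<and> (\<forall>x\<in>pideal v 1. w dvd r2 x)"
proof -
  interpret red: comm_ring_hom red by (rule red_hom)
  obtain p where p: "p \<noteq> 0" "v p = 1" using local_field by (auto simp: nonarch_local_field_def)
  have pO: "p \<in> integers v" "p \<in> pideal v 1" using p by (auto simp: pideal_def)
  have "r2 p * r2 p = 0"
    using r2_hom(2)[OF pO(1,1)] kernels(1)[of "p * p"] pideal_mult[OF pO(2,2)] pideal_mult[OF pO(1,1)]
    by simp
  moreover have dvd: "r2 p dvd r2 x" if x: "x \<in> pideal v 1" for x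
  proof -
    have "x / p \<in> integers v"
      using x p val_mult[of p "x / p"] by (cases "x = 0") (auto simp: pideal_def)
    then have "r2 x = r2 p * r2 (x / p)" using r2_hom(2)[OF pO(1), of "x / p"] p by simp
    then show ?thesis by simp
  qed
  moreover have "red x = 0 \<longleftrightarrow> r2 p dvd x" for x
  proof
    let ?x = "inv_into (integers v) r2 x"
    note l = quotient_map_inv_into[OF r2, of x]
    assume "red x = 0"
    then have "?x \<in> pideal v 1" using kernels(2)[OF l(1)] by (simp add: reduction_def)
    then show "r2 p dvd x" using dvd[of ?x] l(2) by simp
  next
    assume "r2 p dvd x"
    then obtain y where "x = r2 p * y" by (auto simp: dvd_def)
    moreover have "red (r2 p) = 0" using red_r2[OF pO(1)] kernels(2)[OF pO(1)] pO(2) by simp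
    ultimately show "red x = 0" by (simp add: red.hom_mult)
  qed
  ultimately show ?thesis by blast
qed

lemma square_zero_thickening:
  assumes psi: "additive_char_conductor2 v \<psi>"
    and w: "w * w = 0" "\<And>x. red x = 0 \<longleftrightarrow> w dvd x" "\<And>x. x \<in> pideal v 1 \<Longrightarrow> w dvd r2 x"
  shows "square_zero_thickening red w (\<lambda>b. r2 (inv_into (integers v) r1 b))
    (\<lambda>y. \<psi> (inv_into (integers v) r2 y))"
proof -
  interpret red: comm_ring_hom red by (rule red_hom)
  show ?thesis
  proof
    show "red x = 0 \<longleftrightarrow> w dvd x" for x by (rule w)
    show "w * w = 0" by (rule w)
    show "red (r2 (inv_into (integers v) r1 y)) = y" for y
      using red_r2 quotient_map_inv_into[OF r1] by simp
    obtain x where x: "x \<in> pideal v 1" "\<psi> x \<noteq> 1"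
      using psi by (auto simp: additive_char_conductor2_def)
    then obtain y where y: "r2 x = w * y" using w(3) by (auto simp: dvd_def)
    let ?x = "inv_into (integers v) r2 (r2 x)"
    have xO: "x \<in> integers v" using x(1) pideal_mono[of 0 1] by auto
    have d: "?x - x \<in> pideal v 2" by (rule lift_diff[OF xO])
    then have dO: "?x - x \<in> integers v" using pideal_mono[of 0 2] by auto
    have "\<psi> (x + (?x - x)) = \<psi> x * \<psi> (?x - x)"
      using psi xO dO unfolding additive_char_conductor2_def by blast
    also have "\<psi> (?x - x) = 1" using psi d unfolding additive_char_conductor2_def by blast
    finally have "\<psi> ?x \<noteq> 1" using x(2) by simp
    then show "\<exists>y. \<psi> (inv_into (integers v) r2 (w * y)) \<noteq> 1" unfolding y by blast
  qed
qed

text \<open>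
  For all three partitions the last part is 1, so the last coordinate of a vector in the submodule is
  divisible by \<open>w\<close> and is killed by an entry \<open>c\<close> divisible by \<open>w\<close>.
\<close>

lemma elementary_in_U_inf:
  assumes w: "w * w = 0" "\<And>x. x \<in> pideal v 1 \<Longrightarrow> w dvd r2 x"
    and c: "w dvd c" and i: "i < 3" and lam: "lam ! 3 = 1"
  shows "addrow_mat 4 c i 3 \<in> U_inf v r2 lam"
proof -
  have fix_: "addrow_mat 4 c i 3 *\<^sub>v x = x" if x: "x \<in> M_lam v r2 lam" for x
  proof -
    have xc: "x \<in> carrier_vec 4" using x by (simp add: M_lam_def)
    have "\<forall>i<4. x $ i \<in> r2 ` pideal v (2 - int (lam ! i))" using x by (simp add: M_lam_def)
    then have "x $ 3 \<in> r2 ` pideal v (2 - int (lam ! 3))" by (rule allE[of _ 3]) simp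
    then have "x $ 3 \<in> r2 ` pideal v 1" using lam by simp
    then have "w dvd x $ 3" using w(2) by auto
    then obtain s t where "c = w * s" "x $ 3 = w * t" using c by (auto simp: dvd_def)
    then have "c * x $ 3 = (w * w) * (s * t)" by (simp add: ac_simps)
    then have c0: "c * x $ 3 = 0" using w(1) by simp
    show ?thesis
    proof (rule eq_vecI)
      fix p assume "p < dim_vec x"
      then have p: "p < 4" using xc by simp
      have "(addrow_mat 4 c i 3 *\<^sub>v x) $ p = (\<Sum>k<4. addrow_mat 4 c i 3 $$ (p, k) * x $ k)"
        using p xc by (simp add: scalar_prod_def lessThan_atLeast0)
      also have "\<dots> = (\<Sum>k<4. if k = p then x $ k else 0)"
        using p c0 i by (intro sum.cong) (auto simp: algebra_simps)
      also have "\<dots> = x $ p" using p by simp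
      finally show "(addrow_mat 4 c i 3 *\<^sub>v x) $ p = x $ p" .
    qed (use xc in simp)
  qed
  have "addrow_mat 4 c i 3 \<in> carrier (GL TYPE('r) 4)"
    using i by (intro elementary_in_GL) auto
  then show ?thesis using fix_ by (auto simp: U_inf_def P_inf_def)
qed

end

text \<open>
  On elements of determinant one the twist is by \<open>\<chi> 1 = 1\<close>.
\<close>

lemma contains_trivial_untwist:
  fixes \<chi> :: "'r::comm_ring_1 \<Rightarrow> complex"
  assumes \<chi>: "\<chi> \<in> hom (units_of (class_ring :: 'r ring)) (units_of (class_ring :: complex ring))"
    and V: "V \<subseteq> U" "\<And>u. u \<in> V \<Longrightarrow> det u = 1"
    and triv: "contains_trivial U n (\<lambda>g. \<chi> (det g) \<cdot>\<^sub>m \<pi> g)"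
  shows "contains_trivial V n \<pi>"
proof -
  have u: "1 \<in> carrier (units_of (class_ring :: 'r ring))"
    by (auto simp: units_of_def Units_def intro!: exI[of _ 1])
  have "\<chi> (1 * 1) = \<chi> 1 * \<chi> 1"
    using hom_mult[OF \<chi> u u] by (simp add: units_of_def)
  moreover have "\<chi> 1 \<noteq> 0"
    using hom_in_carrier[OF \<chi> u] by (auto simp: units_of_def Units_def)
  ultimately have "\<chi> 1 = 1" by simp
  moreover have "1 \<cdot>\<^sub>m A = A" for A :: "complex mat" by (rule eq_matI) auto
  ultimately show ?thesis using triv V unfolding contains_char_def by (metis subsetD)
qed

theorem proposition2p1:
  fixes v :: "'a::field \<Rightarrow> int"
    and r2 :: "'a \<Rightarrow> 'r::comm_ring_1" and r1 :: "'a \<Rightarrow> 'k::field"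
    and \<psi> :: "'a \<Rightarrow> complex"
    and \<iota> :: "'k \<Rightarrow> 'l::field" and \<eta> :: 'l
    and n :: nat and \<pi> \<rho> :: "'r mat \<Rightarrow> complex mat"
  assumes "nonarch_local_field v"
    and "quotient_map (integers v) (pideal v 2) r2"
    and "quotient_map (integers v) (pideal v 1) r1"
    and "additive_char_conductor2 v \<psi>"
    and "comm_ring_hom \<iota>" and "card (UNIV :: 'l set) = card (UNIV :: 'k set) ^ 2"
    and "generates_over \<iota> \<eta>"
    and "irreducible_rep (GL TYPE('r) 4) n \<pi>"
    and "beta1 \<iota> \<eta> \<in> rep_orbit v r2 r1 \<psi> n \<pi>"
    and "is_rep (GL TYPE('r) 4\<lparr>carrier := char_stabilizer v r2 r1 \<psi> (beta1 \<iota> \<eta>)\<rparr>) 1 \<rho>"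
    and "\<forall>x\<in>K1 v r2 r1. \<rho> x = psi_char v r2 r1 \<psi> (beta1 \<iota> \<eta>) x \<cdot>\<^sub>m 1\<^sub>m 1"
    and "iso_to_induced (GL TYPE('r) 4) n \<pi> (char_stabilizer v r2 r1 \<psi> (beta1 \<iota> \<eta>)) 1 \<rho>"
  shows "cuspidal v r2 n \<pi> \<longleftrightarrow>
    \<not> contains_trivial (char_stabilizer v r2 r1 \<psi> (beta1 \<iota> \<eta>) \<inter> U_geom 2 2) 1 \<rho>"
proof -
  interpret length_two_quotient v r2 r1 by unfold_locales fact+
  obtain a b where ab: "irreducible_quadratic a b" and \<beta>: "beta1 \<iota> \<eta> = jordan_companion a b"
    by (rule quadratic_generator[OF assms(5) finite_residue_field[OF r1] assms(6,7)])
  obtain w where w: "w * w = 0" "\<And>x. red x = 0 \<longleftrightarrow> w dvd x" "\<And>x. x \<in> pideal v 1 \<Longrightarrow> w dvd r2 x"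
    using uniformizer by auto
  let ?lift = "\<lambda>b. r2 (inv_into (integers v) r1 b)" and ?\<Psi> = "\<lambda>y. \<psi> (inv_into (integers v) r2 y)"
  interpret square_zero_thickening red w ?lift ?\<Psi> 4
    by (rule square_zero_thickening[OF assms(4) w])
  have K: "K1 v r2 r1 = K" by (simp add: K1_def K_def)
  have chr: "psi_char v r2 r1 \<psi> = chr" by (intro ext) (simp add: psi_char_def chr_def)
  have stab: "char_stabilizer v r2 r1 \<psi> = stab"
    by (intro ext) (simp add: char_stabilizer_def stab_def K chr)
  interpret quad: irreducible_quadratic a b by (rule ab)
  interpret thickening_with_beta red w ?lift ?\<Psi> a b "beta1 \<iota> \<eta>" \<rho>
    by unfold_locales (use \<beta> assms(11) in \<open>auto simp: K chr\<close>)
  let ?S = "stab (beta1 \<iota> \<eta>)"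
  have rep\<pi>: "is_rep G n \<pi>" using assms(8) by (simp add: irreducible_rep_def)
  have iso: "iso_to_induced G n \<pi> ?S 1 \<rho>" using assms(12) by (simp add: stab)
  have U_sub: "U_geom i j \<subseteq> carrier G" if "i + j = 4" for i j
    using subgroup.subset[OF U_geom_subgroup[of i j]] that by simp
  have fixed: "\<exists>f g. f \<in> ind_space G ?S 1 \<rho> \<and> g \<in> carrier G \<and> f g \<noteq> 0\<^sub>v 1 \<and>
      (\<forall>x\<in>carrier G. \<forall>u\<in>V. f (x * u) = f x)"
    if "\<chi> \<in> hom (units_of class_ring) (units_of class_ring)" "V \<subseteq> U" "V \<subseteq> carrier G"
      "\<And>u. u \<in> V \<Longrightarrow> det u = 1" "contains_trivial U n (\<lambda>g. \<chi> (det g) \<cdot>\<^sub>m \<pi> g)" for \<chi> U V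
  proof -
    have "contains_trivial V n \<pi>" by (rule contains_trivial_untwist[OF that(1,2,4,5)])
    show ?thesis
    proof (rule fixed_function_if_contains_trivial[OF that(3) iso \<open>contains_trivial V n \<pi>\<close>])
      fix f g assume "f \<in> ind_space G ?S 1 \<rho>" "g \<in> carrier G" "f g \<noteq> 0\<^sub>v 1"
        "\<And>x u. x \<in> carrier G \<Longrightarrow> u \<in> V \<Longrightarrow> f (x \<otimes>\<^bsub>G\<^esub> u) = f x"
      then show ?thesis by (intro exI[of _ f] exI[of _ g]) simp
    qed
  qed
  show ?thesis
    unfolding stab
  proof
    assume cusp: "cuspidal v r2 n \<pi>"
    show "\<not> contains_trivial (?S \<inter> U_geom 2 2) 1 \<rho>"
    proof
      assume "contains_trivial (?S \<inter> U_geom 2 2) 1 \<rho>"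
      then obtain x where x: "x \<in> carrier_vec 1" "x \<noteq> 0\<^sub>v 1"
        and fx: "\<And>h. h \<in> ?S \<inter> U_geom 2 2 \<Longrightarrow> \<rho> h *\<^sub>v x = x"
        unfolding contains_char_def by auto
      have U: "subgroup (U_geom 2 2) G" using U_geom_subgroup[of 2 2] by simp
      have "contains_trivial (U_geom 2 2) n \<pi>"
      proof (rule function_supported_on_double_coset[OF group_GL stab_subgroup U assms(10)[unfolded stab] x(1) fx])
        fix f assume f: "f \<in> ind_space G ?S 1 \<rho>" "f \<one>\<^bsub>G\<^esub> = x"
          "\<And>x u. x \<in> carrier G \<Longrightarrow> u \<in> U_geom 2 2 \<Longrightarrow> f (x \<otimes>\<^bsub>G\<^esub> u) = f x"
        have "f \<one>\<^bsub>G\<^esub> \<noteq> 0\<^sub>v 1" using f(2) x(2) by simp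
        then show ?thesis
          by (rule contains_trivial_if_fixed_function[where f = f, OF subgroup.subset[OF U] rep\<pi> iso f(1) _ f(3)])
      qed
      moreover have "(\<lambda>_. 1) \<in> hom (units_of (class_ring :: 'r ring)) (units_of (class_ring :: complex ring))"
        by (auto simp: hom_def units_of_def Units_def intro!: exI[of _ 1])
      then have "\<not> contains_trivial (U_geom 2 2) n (\<lambda>g. 1 \<cdot>\<^sub>m \<pi> g)"
        using cusp unfolding cuspidal_def by fastforce
      moreover have "1 \<cdot>\<^sub>m A = A" for A :: "complex mat" by (rule eq_matI) auto
      ultimately show False by simp
    qed
  next
    assume nt: "\<not> contains_trivial (?S \<inter> U_geom 2 2) 1 \<rho>"
    have geom: "\<not> contains_trivial (U_geom i j) n (\<lambda>g. \<chi> (det g) \<cdot>\<^sub>m \<pi> g)"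
      if \<chi>: "\<chi> \<in> hom (units_of class_ring) (units_of class_ring)"
        and ij: "(i, j) \<in> {(1, 3), (2, 2), (3, 1)}" for \<chi> i j
    proof
      assume ct: "contains_trivial (U_geom i j) n (\<lambda>g. \<chi> (det g) \<cdot>\<^sub>m \<pi> g)"
      have s: "i + j = 4" using ij by auto
      have "\<exists>f g. f \<in> ind_space G ?S 1 \<rho> \<and> g \<in> carrier G \<and> f g \<noteq> 0\<^sub>v 1 \<and>
          (\<forall>x\<in>carrier G. \<forall>u\<in>U_geom i j. f (x * u) = f x)"
        by (rule fixed[OF \<chi> subset_refl U_sub[OF s] _ ct]) (rule det_U_geom)
      then obtain f g where f: "f \<in> ind_space G ?S 1 \<rho>" "g \<in> carrier G" "f g \<noteq> 0\<^sub>v 1"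
        and inv: "\<And>x u. x \<in> carrier G \<Longrightarrow> u \<in> U_geom i j \<Longrightarrow> f (x * u) = f x"
        by blast
      have el: "addrow_mat 4 c p q \<in> U_geom i j" if "p < i" "i \<le> q" "q < 4" for c :: 'r and p q
        using elementary_in_U_geom[of p i q j c] that s by simp
      consider "i = 1" "j = 3" | "i = 2" "j = 2" | "i = 3" "j = 1" using ij by auto
      then show False
      proof cases
        case 1
        show False by (rule no_line_fixed[OF f]) (rule inv[OF f(2)], rule el, use 1 in auto)
      next
        case 2
        show False using plane_fixed_imp_trivial[OF f] inv nt 2 by blast
      next
        case 3
        show False by (rule no_hyperplane_fixed[OF f]) (rule inv[OF f(2)], rule el, use 3 in auto)
      qed
    qed
    have inf: "\<not> contains_trivial (U_inf v r2 lam) n (\<lambda>g. \<chi> (det g) \<cdot>\<^sub>m \<pi> g)"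
      if \<chi>: "\<chi> \<in> hom (units_of class_ring) (units_of class_ring)" and lam: "lam ! 3 = 1" for \<chi> lam
    proof
      assume ct: "contains_trivial (U_inf v r2 lam) n (\<lambda>g. \<chi> (det g) \<cdot>\<^sub>m \<pi> g)"
      \<comment> \<open>The elementary matrices in the intersection of the congruence subgroup with \<open>U_geom 3 1\<close>; all
        three infinitesimal groups contain them.\<close>
      define V where "V = {addrow_mat 4 c i 3 | c i. w dvd c \<and> i < 3}"
      have V: "V \<subseteq> U_inf v r2 lam" "V \<subseteq> carrier G"
        using elementary_in_U_inf[OF w(1,3) _ _ lam] by (auto simp: V_def intro!: elementary_in_GL)
      have det_V: "det u = 1" if "u \<in> V" for u using that by (auto simp: V_def det_addrow_mat)
      have "\<exists>f g. f \<in> ind_space G ?S 1 \<rho> \<and> g \<in> carrier G \<and> f g \<noteq> 0\<^sub>v 1 \<and>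
          (\<forall>x\<in>carrier G. \<forall>u\<in>V. f (x * u) = f x)"
        by (rule fixed[OF \<chi> V _ ct]) (rule det_V)
      then obtain f g where f: "f \<in> ind_space G ?S 1 \<rho>" "g \<in> carrier G" "f g \<noteq> 0\<^sub>v 1"
        and inv: "\<forall>x\<in>carrier G. \<forall>u\<in>V. f (x * u) = f x"
        by blast
      show False
      proof (rule no_hyperplane_fixed[OF f])
        fix c :: 'r and i :: nat assume "w dvd c" "i \<in> {0, 1, 2}"
        then have "w dvd c \<and> i < 3" by auto
        then have "addrow_mat 4 c i 3 \<in> V" unfolding V_def by (intro CollectI exI[of _ c] exI[of _ i]) auto
        then show "f (g * addrow_mat 4 c i 3) = f g" using inv f(2) by blast
      qed
    qed
    show "cuspidal v r2 n \<pi>"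
      unfolding cuspidal_def
    proof (intro conjI ballI)
      show "irreducible_rep G n \<pi>" by (rule assms(8))
    next
      fix \<chi> :: "'r \<Rightarrow> complex" and p :: "nat \<times> nat"
      assume \<chi>: "\<chi> \<in> hom (units_of class_ring) (units_of class_ring)"
        and p: "p \<in> {(1, 3), (2, 2), (3, 1)}"
      obtain i j where ij: "p = (i, j)" by (cases p)
      show "case p of (i, j) \<Rightarrow> \<not> contains_trivial (U_geom i j) n (\<lambda>g. \<chi> (det g) \<cdot>\<^sub>m \<pi> g)"
        unfolding ij prod.case by (rule geom[OF \<chi>]) (use p ij in simp)
    next
      fix \<chi> :: "'r \<Rightarrow> complex" and lam :: "nat list"
      assume \<chi>: "\<chi> \<in> hom (units_of class_ring) (units_of class_ring)"
        and lam: "lam \<in> {[2, 1, 1, 1], [2, 2, 1, 1], [2, 2, 2, 1]}"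
      show "\<not> contains_trivial (U_inf v r2 lam) n (\<lambda>g. \<chi> (det g) \<cdot>\<^sub>m \<pi> g)"
        by (rule inf[OF \<chi>]) (use lam in auto)
    qed
  qed
qed

end
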